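(* Let $\Gamma$ be a connected 3-valent Feynman graph without loops, with vertices $x_1,\dots,x_n$ and edges $q_1,\dots,q_r$. Fix a multidegree $\underline a\in\mathbb N^r$ and an order $\Omega$ of the vertices. Then the count $N_{\Gamma,\underline a,\Omega}$ of labeled tropical covers of $E_{\mathbb T}$ of type $\Gamma$, multidegree $\underline a$ and order $\Omega$ equals a sum of matrix elements: $$N_{\Gamma,\underline a,\Omega}=\sum_{\substack{(w_k)_k\\ w_k|a_k}}\ \prod_{k=1}^r\Big(\frac1{w_k}\Big)^{\frac{a_k}{w_k}}\cdot\Bigg\langle\prod_{k=1}^r\prod_{l=1}^{\frac{a_k}{w_k}}\alpha^{k,l}_{-w_k}v_\varnothing\ \Bigg|\ \prod_{i=1}^nM_{\Omega^{-1}(i)}\ \Bigg|\ \prod_{k=1}^r\prod_{l=2}^{\frac{a_k}{w_k}+1}\alpha^{k,l}_{-w_k}v_\varnothing\Bigg\rangle,$$ where the sum is over all tuples $(w_k)_{k:\,a_k>0}$ of positive integers with $w_k|a_k$, and indices $k$ with $a_k=0$ contribute only empty products to the prefactor and to the two vectors.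
   Context: $\mathbb N=\{0,1,2,\dots\}$. GRAPHS AND COVERS. A Feynman graph is a multigraph without ends with vertices labeled $x_1,\dots,x_n$ ($n>1$) and edges labeled $q_1,\dots,q_r$. An order $\Omega$ is a total ordering of the vertices, viewed as a permutation: $\Omega(i)$ is the place of $x_i$. $E_{\mathbb T}$ is an oriented circle of fixed length with distinct points $p_0,p_1,\dots,p_n$ met in this order when going around in the orientation starting at $p_0$. A (labeled) tropical cover, or graph cover, of type $\Gamma$, order $\Omega$ and multidegree $\underline a$ is a surjective map $\pi:\Gamma'\to E_{\mathbb T}$, with $\Gamma'$ a metrization of $\Gamma$ (keeping labels), which is piecewise integer affine linear with positive integer slope $\omega(q_k)$ (expansion factor) on each edge $q_k$, with $x_i\in\pi^{-1}(p_{\Omega(i)})$ for all $i$, balanced at each vertex (the sum of the expansion factors of the flags at $x_i$ mapping to one of the two flags of $E_{\mathbb T}$ at $p_{\Omega(i)}$ equals the sum for the other flag), and with $|\pi^{-1}(p_0)\cap q_k|\cdot\omega(q_k)=a_k$ for all $k$. $N_{\Gamma,\underline a,\Omega}$ is the number of such covers, up to isomorphism respecting labels, each counted with $\prod_k\omega(q_k)$. FOCK SPACE. Consider operators $\alpha^{k,j}_n$ for $k=1,\dots,r$, $j=1,\dots,a_k+1$, $n\in\mathbb Z\setminus\{0\}$, and $\alpha_0$, with commutators $$[\alpha^{k,j}_n,\alpha^{l,i}_m]=(n\cdot\delta_{k,l}\cdot\delta_{j,i}\cdot\delta_{n,-m})\,\alpha_0.$$ The bosonic Fock space $F$ is generated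 by the vacuum vector $v_\varnothing$, where $\alpha^{k,j}_n v_\varnothing=0$ for $n>0$, $\alpha_0$ acts as the identity, and the operators with negative subscript act freely. The inner product on $F$ is determined by $\langle v_\varnothing|v_\varnothing\rangle=1$ and $\alpha^{k,j}_n$ being adjoint to $\alpha^{k,j}_{-n}$. For $v,w\in F$ and an operator $A$, the matrix element is $\langle v|A|w\rangle=\langle v|Aw\rangle$. LABELED CUT-JOIN OPERATOR. Fix $(w_k)_{k:a_k>0}$ with $w_k|a_k$. Let $x_i$ be a vertex with its three adjacent edges $q_{i_1},q_{i_2},q_{i_3}$. For $l=1,2,3$ set $c_l=\frac{a_{i_l}}{w_{i_l}}+1$ if $a_{i_l}>0$ and $c_l=1$ otherwise; and $d_{m_l}=c_l$ if $m_l>0$, $d_{m_l}=1$ otherwise. Then $$M_i=\sum_{\substack{m_1,m_2,m_3\in\mathbb Z\setminus\{0\}\\ m_1+m_2+m_3=0}}\alpha^{i_1,d_{m_1}}_{m_1}\,\alpha^{i_2,d_{m_2}}_{m_2}\,\alpha^{i_3,d_{m_3}}_{m_3}.$$ The product $\prod_{i=1}^nM_{\Omega^{-1}(i)}$ is the ordered product $M_{\Omega^{-1}(1)}M_{\Omega^{-1}(2)}\cdots M_{\Omega^{-1}(n)}$, read from left to right. *)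

theory Defs
  imports
    "HOL-Analysis.Analysis"
    "HOL-Combinatorics.Permutations"
    "HOL-Library.Multiset"
    "HOL-Library.Poly_Mapping"
    "HOL-Library.Real_Mod"
begin

section \<open>Feynman graphs\<close>

text \<open>
  The vertices $x_1,\dots,x_n$ and the edges $q_1,\dots,q_r$ are represented by their indices in
  \<open>{1..n}\<close> and \<open>{1..r}\<close>, and \<open>ends k\<close> is the set of the vertices adjacent to $q_k$; it is a
  singleton if $q_k$ is a loop. A flag of the graph is a pair \<open>(k, e)\<close> of an edge and one of
  its two ends: \<open>e = False\<close> is the end at the vertex \<open>Min (ends k)\<close>, and \<open>e = True\<close> is the end
  at \<open>Max (ends k)\<close>. This only serves to tell the two ends of an edge apart; edges are
  not oriented.
\<close>

definition feynman_graph :: "nat \<Rightarrow> nat \<Rightarrow> (nat \<Rightarrow> nat set) \<Rightarrow> bool" where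
  "feynman_graph n r ends \<longleftrightarrow>
     n > 1 \<and> (\<forall>k\<in>{1..r}. ends k \<subseteq> {1..n} \<and> card (ends k) \<in> {1, 2})"

fun flag_vertex :: "(nat \<Rightarrow> nat set) \<Rightarrow> nat \<times> bool \<Rightarrow> nat" where
  "flag_vertex ends (k, e) = (if e then Max (ends k) else Min (ends k))"

definition flags_at :: "nat \<Rightarrow> (nat \<Rightarrow> nat set) \<Rightarrow> nat \<Rightarrow> (nat \<times> bool) set" where
  "flags_at r ends i = {f. fst f \<in> {1..r} \<and> flag_vertex ends f = i}"

definition three_valent :: "nat \<Rightarrow> nat \<Rightarrow> (nat \<Rightarrow> nat set) \<Rightarrow> bool" where
  "three_valent n r ends \<longleftrightarrow> (\<forall>i\<in>{1..n}. card (flags_at r ends i) = 3)"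

definition loopless :: "nat \<Rightarrow> (nat \<Rightarrow> nat set) \<Rightarrow> bool" where
  "loopless r ends \<longleftrightarrow> (\<forall>k\<in>{1..r}. card (ends k) \<noteq> 1)"

definition graph_connected :: "nat \<Rightarrow> nat \<Rightarrow> (nat \<Rightarrow> nat set) \<Rightarrow> bool" where
  "graph_connected n r ends \<longleftrightarrow>
     (\<forall>i\<in>{1..n}. \<forall>j\<in>{1..n}. (i, j) \<in> {(u, v). \<exists>k\<in>{1..r}. ends k = {u, v}}\<^sup>*)"


section \<open>Metrizations and the circle\<close>

datatype gpoint = Vertex nat | Inner nat real

text \<open>
  For a length function \<open>len\<close>, the closed edge $q_k$ is the interval \<open>{0..len k}\<close> whose
  two end points are glued to the vertices of $q_k$.
\<close>

definition edge_point :: "(nat \<Rightarrow> nat set) \<Rightarrow> (nat \<Rightarrow> real) \<Rightarrow> nat \<Rightarrow> real \<Rightarrow> gpoint" where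
  "edge_point ends len k t =
     (if t = 0 then Vertex (Min (ends k)) else if t = len k then Vertex (Max (ends k)) else Inner k t)"

definition edge_set :: "(nat \<Rightarrow> nat set) \<Rightarrow> (nat \<Rightarrow> real) \<Rightarrow> nat \<Rightarrow> gpoint set" where
  "edge_set ends len k = edge_point ends len k ` {0..len k}"

definition metric_graph :: "nat \<Rightarrow> nat \<Rightarrow> (nat \<Rightarrow> nat set) \<Rightarrow> (nat \<Rightarrow> real) \<Rightarrow> gpoint set" where
  "metric_graph n r ends len = Vertex ` {1..n} \<union> (\<Union>k\<in>{1..r}. edge_set ends len k)"

text \<open>\<open>flag_point ends len (k, e) t\<close> is the point of $q_k$ at distance \<open>t\<close> from the end \<open>e\<close>.\<close>

fun flag_point :: "(nat \<Rightarrow> nat set) \<Rightarrow> (nat \<Rightarrow> real) \<Rightarrow> nat \<times> bool \<Rightarrow> real \<Rightarrow> gpoint" where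
  "flag_point ends len (k, e) t = edge_point ends len k (if e then len k - t else t)"

text \<open>
  The oriented circle of length \<open>L\<close> is $\mathbb{R}/L\mathbb{Z}$, oriented by increasing
  representatives; \<open>circle_pt L t\<close> is the class of \<open>t\<close>.
\<close>

definition circle_pt :: "real \<Rightarrow> real \<Rightarrow> real set" where
  "circle_pt L t = {s. [s = t] (rmod L)}"

definition circle :: "real \<Rightarrow> real set set" where
  "circle L = range (circle_pt L)"


section \<open>Tropical covers\<close>

text \<open>
  A cover consists of the edge lengths of the metrization, the expansion factors and the map.
  The distinct points $p_0,\dots,p_n$ of the circle, met in this order, are the classes of
  real numbers \<open>P 0 < \<dots> < P n < P 0 + L\<close>.
\<close>

type_synonym cover = "(nat \<Rightarrow> real) \<times> (nat \<Rightarrow> nat) \<times> (gpoint \<Rightarrow> real set)"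

text \<open>
  The flag \<open>f\<close> is mapped, with slope \<open>\<omega>\<close>, to the flag of the circle that leaves the image of
  the vertex in the direction of the orientation if \<open>s = 1\<close>, and against it if \<open>s = -1\<close>.
\<close>

definition maps_flag ::
  "real \<Rightarrow> (nat \<Rightarrow> nat set) \<Rightarrow> cover \<Rightarrow> nat \<times> bool \<Rightarrow> real \<Rightarrow> bool" where
  "maps_flag L ends c f s = (case c of (len, \<omega>, \<pi>) \<Rightarrow>
     (\<exists>b. \<exists>\<epsilon>>0. \<epsilon> \<le> len (fst f) \<and>
        (\<forall>t\<in>{0..\<epsilon>}. \<pi> (flag_point ends len f t) = circle_pt L (b + s * real (\<omega> (fst f)) * t))))"

definition balanced_at ::
  "real \<Rightarrow> nat \<Rightarrow> (nat \<Rightarrow> nat set) \<Rightarrow> cover \<Rightarrow> nat \<Rightarrow> bool" where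
  "balanced_at L r ends c i = (case c of (len, \<omega>, \<pi>) \<Rightarrow>
     (\<Sum>f | f \<in> flags_at r ends i \<and> maps_flag L ends c f 1. \<omega> (fst f)) =
     (\<Sum>f | f \<in> flags_at r ends i \<and> maps_flag L ends c f (-1). \<omega> (fst f)))"

definition is_cover ::
  "real \<Rightarrow> (nat \<Rightarrow> real) \<Rightarrow> nat \<Rightarrow> nat \<Rightarrow> (nat \<Rightarrow> nat set) \<Rightarrow> (nat \<Rightarrow> nat) \<Rightarrow> (nat \<Rightarrow> nat)
     \<Rightarrow> cover \<Rightarrow> bool" where
  "is_cover L P n r ends a \<Omega> c = (case c of (len, \<omega>, \<pi>) \<Rightarrow>
     (\<forall>k\<in>{1..r}. len k > 0) \<and>
     \<pi> ` metric_graph n r ends len = circle L \<and>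
     (\<forall>k\<in>{1..r}. \<omega> k > 0 \<and>
        (\<exists>b. \<exists>s\<in>{1, -1}. \<forall>t\<in>{0..len k}.
            \<pi> (edge_point ends len k t) = circle_pt L (b + s * real (\<omega> k) * t))) \<and>
     (\<forall>i\<in>{1..n}. \<pi> (Vertex i) = circle_pt L (P (\<Omega> i))) \<and>
     (\<forall>i\<in>{1..n}. balanced_at L r ends c i) \<and>
     (\<forall>k\<in>{1..r}. card {x \<in> edge_set ends len k. \<pi> x = circle_pt L (P 0)} * \<omega> k = a k))"

text \<open>Isomorphisms of metric graphs that fix all vertex and edge labels.\<close>

definition labeled_isometry ::
  "nat \<Rightarrow> nat \<Rightarrow> (nat \<Rightarrow> nat set) \<Rightarrow> (nat \<Rightarrow> real) \<Rightarrow> (nat \<Rightarrow> real) \<Rightarrow> (gpoint \<Rightarrow> gpoint) \<Rightarrow> bool" where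
  "labeled_isometry n r ends len len' \<phi> \<longleftrightarrow>
     bij_betw \<phi> (metric_graph n r ends len) (metric_graph n r ends len') \<and>
     (\<forall>i\<in>{1..n}. \<phi> (Vertex i) = Vertex i) \<and>
     (\<forall>k\<in>{1..r}. \<exists>g. bij_betw g {0..len k} {0..len' k} \<and>
        (\<forall>s\<in>{0..len k}. \<forall>t\<in>{0..len k}. \<bar>g s - g t\<bar> = \<bar>s - t\<bar>) \<and>
        (\<forall>t\<in>{0..len k}. \<phi> (edge_point ends len k t) = edge_point ends len' k (g t)))"

definition cover_iso ::
  "real \<Rightarrow> (nat \<Rightarrow> real) \<Rightarrow> nat \<Rightarrow> nat \<Rightarrow> (nat \<Rightarrow> nat set) \<Rightarrow> (nat \<Rightarrow> nat) \<Rightarrow> (nat \<Rightarrow> nat)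
     \<Rightarrow> (cover \<times> cover) set" where
  "cover_iso L P n r ends a \<Omega> =
     {((len, \<omega>, \<pi>), (len', \<omega>', \<pi>')).
        is_cover L P n r ends a \<Omega> (len, \<omega>, \<pi>) \<and> is_cover L P n r ends a \<Omega> (len', \<omega>', \<pi>') \<and>
        (\<exists>\<phi>. labeled_isometry n r ends len len' \<phi> \<and>
             (\<forall>x\<in>metric_graph n r ends len. \<pi>' (\<phi> x) = \<pi> x))}"

definition cover_mult :: "nat \<Rightarrow> cover \<Rightarrow> nat" where
  "cover_mult r c = (case c of (len, \<omega>, \<pi>) \<Rightarrow> \<Prod>k=1..r. \<omega> k)"

text \<open>
  The sum runs over the isomorphism classes of covers; the multiplicity of a class is the common
  multiplicity of its members, the expansion factors on \<open>{1..r}\<close> being determined by the map.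
\<close>

definition cover_count ::
  "real \<Rightarrow> (nat \<Rightarrow> real) \<Rightarrow> nat \<Rightarrow> nat \<Rightarrow> (nat \<Rightarrow> nat set) \<Rightarrow> (nat \<Rightarrow> nat) \<Rightarrow> (nat \<Rightarrow> nat) \<Rightarrow> nat" where
  "cover_count L P n r ends a \<Omega> =
     (\<Sum>C \<in> {c. is_cover L P n r ends a \<Omega> c} // cover_iso L P n r ends a \<Omega>.
        the_elem (cover_mult r ` C))"

lemma labeled_isometry_id: "labeled_isometry n r ends len len id"
  unfolding labeled_isometry_def by (auto intro!: exI[of _ id])

lemma labeled_isometry_inv:
  assumes "labeled_isometry n r ends len len' \<phi>"
  shows "labeled_isometry n r ends len' len (inv_into (metric_graph n r ends len) \<phi>)"
proof -
  let ?A = "metric_graph n r ends len"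
  let ?\<psi> = "inv_into ?A \<phi>"
  have bij: "bij_betw \<phi> ?A (metric_graph n r ends len')"
    using assms by (simp add: labeled_isometry_def)
  have inv: "?\<psi> (\<phi> x) = x" if "x \<in> ?A" for x
    using bij that by (rule bij_betw_inv_into_left)
  have V: "?\<psi> (Vertex i) = Vertex i" if "i \<in> {1..n}" for i
    using inv[of "Vertex i"] assms that by (auto simp: labeled_isometry_def metric_graph_def)
  have "\<exists>g. bij_betw g {0..len' k} {0..len k} \<and>
        (\<forall>s\<in>{0..len' k}. \<forall>t\<in>{0..len' k}. \<bar>g s - g t\<bar> = \<bar>s - t\<bar>) \<and>
        (\<forall>t\<in>{0..len' k}. ?\<psi> (edge_point ends len' k t) = edge_point ends len k (g t))"
    if k: "k \<in> {1..r}" for k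
  proof -
    obtain g where g: "bij_betw g {0..len k} {0..len' k}"
      "\<And>s t. s \<in> {0..len k} \<Longrightarrow> t \<in> {0..len k} \<Longrightarrow> \<bar>g s - g t\<bar> = \<bar>s - t\<bar>"
      "\<And>t. t \<in> {0..len k} \<Longrightarrow> \<phi> (edge_point ends len k t) = edge_point ends len' k (g t)"
      using assms k unfolding labeled_isometry_def by blast
    let ?h = "inv_into {0..len k} g"
    have h: "bij_betw ?h {0..len' k} {0..len k}"
      using g(1) by (rule bij_betw_inv_into)
    have hin: "?h t \<in> {0..len k}" if "t \<in> {0..len' k}" for t
      using h that by (rule bij_betwE[THEN bspec])
    have gh: "g (?h t) = t" if "t \<in> {0..len' k}" for t
      using g(1) that by (rule bij_betw_inv_into_right)
    have "?\<psi> (edge_point ends len' k t) = edge_point ends len k (?h t)" if t: "t \<in> {0..len' k}" for t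
    proof -
      have "edge_point ends len k (?h t) \<in> ?A"
        using hin[OF t] k unfolding metric_graph_def edge_set_def by blast
      from inv[OF this] show ?thesis using g(3)[OF hin[OF t]] gh[OF t] by simp
    qed
    moreover have "\<bar>?h s - ?h t\<bar> = \<bar>s - t\<bar>" if "s \<in> {0..len' k}" "t \<in> {0..len' k}" for s t
      using g(2)[OF hin[OF that(1)] hin[OF that(2)]] gh that by simp
    ultimately show ?thesis using h by blast
  qed
  thus ?thesis
    unfolding labeled_isometry_def using V bij_betw_inv_into[OF bij] by blast
qed

lemma labeled_isometry_comp:
  assumes "labeled_isometry n r ends len len' \<phi>" "labeled_isometry n r ends len' len'' \<psi>"
  shows "labeled_isometry n r ends len len'' (\<psi> \<circ> \<phi>)"
proof -
  have "\<exists>g. bij_betw g {0..len k} {0..len'' k} \<and>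
        (\<forall>s\<in>{0..len k}. \<forall>t\<in>{0..len k}. \<bar>g s - g t\<bar> = \<bar>s - t\<bar>) \<and>
        (\<forall>t\<in>{0..len k}. (\<psi> \<circ> \<phi>) (edge_point ends len k t) = edge_point ends len'' k (g t))"
    if k: "k \<in> {1..r}" for k
  proof -
    obtain g where g: "bij_betw g {0..len k} {0..len' k}"
      "\<And>s t. s \<in> {0..len k} \<Longrightarrow> t \<in> {0..len k} \<Longrightarrow> \<bar>g s - g t\<bar> = \<bar>s - t\<bar>"
      "\<And>t. t \<in> {0..len k} \<Longrightarrow> \<phi> (edge_point ends len k t) = edge_point ends len' k (g t)"
      using assms(1) k unfolding labeled_isometry_def by blast
    obtain h where h: "bij_betw h {0..len' k} {0..len'' k}"
      "\<And>s t. s \<in> {0..len' k} \<Longrightarrow> t \<in> {0..len' k} \<Longrightarrow> \<bar>h s - h t\<bar> = \<bar>s - t\<bar>"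
      "\<And>t. t \<in> {0..len' k} \<Longrightarrow> \<psi> (edge_point ends len' k t) = edge_point ends len'' k (h t)"
      using assms(2) k unfolding labeled_isometry_def by blast
    have gin: "g t \<in> {0..len' k}" if "t \<in> {0..len k}" for t
      using g(1) that by (rule bij_betwE[THEN bspec])
    show ?thesis
      by (rule exI[of _ "h \<circ> g"]) (use bij_betw_trans[OF g(1) h(1)] g(2,3) h(2,3) gin in simp)
  qed
  moreover have "bij_betw (\<psi> \<circ> \<phi>) (metric_graph n r ends len) (metric_graph n r ends len'')"
    by (rule bij_betw_trans[where B = "metric_graph n r ends len'"])
       (use assms in \<open>simp_all add: labeled_isometry_def\<close>)
  moreover have "\<forall>i\<in>{1..n}. (\<psi> \<circ> \<phi>) (Vertex i) = Vertex i"
    using assms by (simp add: labeled_isometry_def)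
  ultimately show ?thesis
    unfolding labeled_isometry_def by blast
qed

lemma equiv_cover_iso:
  "equiv {c. is_cover L P n r ends a \<Omega> c} (cover_iso L P n r ends a \<Omega>)"
proof (intro equivI)
  show "cover_iso L P n r ends a \<Omega> \<subseteq>
      {c. is_cover L P n r ends a \<Omega> c} \<times> {c. is_cover L P n r ends a \<Omega> c}"
    by (auto simp: cover_iso_def)
  show "refl_on {c. is_cover L P n r ends a \<Omega> c} (cover_iso L P n r ends a \<Omega>)"
    by (auto simp: refl_on_def cover_iso_def intro!: exI[of _ id] labeled_isometry_id)
  show "sym (cover_iso L P n r ends a \<Omega>)"
  proof (rule symI, clarsimp simp: cover_iso_def)
    fix len len' :: "nat \<Rightarrow> real" and \<pi> \<pi>' :: "gpoint \<Rightarrow> real set" and \<phi>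
    assume iso: "labeled_isometry n r ends len len' \<phi>"
      and eq: "\<forall>x\<in>metric_graph n r ends len. \<pi>' (\<phi> x) = \<pi> x"
    let ?\<psi> = "inv_into (metric_graph n r ends len) \<phi>"
    have bij: "bij_betw \<phi> (metric_graph n r ends len) (metric_graph n r ends len')"
      using iso by (simp add: labeled_isometry_def)
    have "\<pi> (?\<psi> x) = \<pi>' x" if x: "x \<in> metric_graph n r ends len'" for x
      using eq bij_betw_inv_into_right[OF bij x] bij_betwE[OF bij_betw_inv_into[OF bij]] x by metis
    thus "\<exists>\<phi>. labeled_isometry n r ends len' len \<phi> \<and>
        (\<forall>x\<in>metric_graph n r ends len'. \<pi> (\<phi> x) = \<pi>' x)"
      using labeled_isometry_inv[OF iso] by blast
  qed
  show "trans (cover_iso L P n r ends a \<Omega>)"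
  proof (rule transI, clarsimp simp: cover_iso_def)
    fix len len' len'' :: "nat \<Rightarrow> real" and \<pi> \<pi>' \<pi>'' :: "gpoint \<Rightarrow> real set" and \<phi> \<psi>
    assume iso: "labeled_isometry n r ends len len' \<phi>" "labeled_isometry n r ends len' len'' \<psi>"
      and eq: "\<forall>x\<in>metric_graph n r ends len. \<pi>' (\<phi> x) = \<pi> x"
        "\<forall>x\<in>metric_graph n r ends len'. \<pi>'' (\<psi> x) = \<pi>' x"
    have "\<phi> x \<in> metric_graph n r ends len'" if "x \<in> metric_graph n r ends len" for x
      using iso(1) that by (auto simp: labeled_isometry_def bij_betw_def)
    hence "\<forall>x\<in>metric_graph n r ends len. \<pi>'' ((\<psi> \<circ> \<phi>) x) = \<pi> x"
      using eq by simp
    thus "\<exists>\<phi>. labeled_isometry n r ends len len'' \<phi> \<and>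
        (\<forall>x\<in>metric_graph n r ends len. \<pi>'' (\<phi> x) = \<pi> x)"
      using labeled_isometry_comp[OF iso] by blast
  qed
qed


section \<open>The Fock space\<close>

text \<open>
  A mode \<open>(k, j, n)\<close> with \<open>n > 0\<close> stands for the creation operator $\alpha^{k,j}_{-n}$. Since the
  creation operators commute and act freely on the vacuum, the Fock space is the polynomial
  algebra in the modes, with the monomials indexed by multisets of modes and the vacuum as unit.
  For simplicity the type admits arbitrary indices \<open>k\<close>, \<open>j\<close> and \<open>n\<close>; the space generated by the
  operators with \<open>1 \<le> k \<le> r\<close> and \<open>1 \<le> j \<le> a k + 1\<close> is the subspace \<open>fock_space r a\<close>.
\<close>

type_synonym mode = "nat \<times> nat \<times> nat"
type_synonym fock = "mode multiset \<Rightarrow>\<^sub>0 real"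

definition modes :: "nat \<Rightarrow> (nat \<Rightarrow> nat) \<Rightarrow> mode set" where
  "modes r a = {(k, j, n). k \<in> {1..r} \<and> j \<in> {1..a k + 1} \<and> n > 0}"

definition fock_space :: "nat \<Rightarrow> (nat \<Rightarrow> nat) \<Rightarrow> fock set" where
  "fock_space r a = {v. \<forall>\<mu>\<in>Poly_Mapping.keys v. set_mset \<mu> \<subseteq> modes r a}"

definition vacuum :: fock where
  "vacuum = 1"

definition create :: "mode \<Rightarrow> fock \<Rightarrow> fock" where
  "create x v = Poly_Mapping.single {#x#} 1 * v"

text \<open>
  The commutator relation forces the annihilation operator $\alpha^{k,j}_n$, $n > 0$, to act as
  $n$ times the partial derivative in the direction of the mode \<open>(k, j, n)\<close>.
\<close>

lift_definition annihilate :: "mode \<Rightarrow> fock \<Rightarrow> fock" is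
  "\<lambda>x v \<mu>. real (snd (snd x)) * real (count \<mu> x + 1) * v (add_mset x \<mu>)"
proof -
  fix x :: mode and v :: "mode multiset \<Rightarrow> real"
  assume "finite {\<mu>. v \<mu> \<noteq> 0}"
  hence "finite (add_mset x -` {\<mu>. v \<mu> \<noteq> 0})"
    by (rule finite_vimageI) (simp add: inj_def)
  thus "finite {\<mu>. real (snd (snd x)) * real (count \<mu> x + 1) * v (add_mset x \<mu>) \<noteq> 0}"
    by (rule finite_subset[rotated]) auto
qed

definition alpha :: "nat \<Rightarrow> nat \<Rightarrow> int \<Rightarrow> fock \<Rightarrow> fock" where
  "alpha k j m =
     (if m > 0 then annihilate (k, j, nat m) else if m < 0 then create (k, j, nat (-m)) else id)"

text \<open>
  Distinct monomials are orthogonal, and $\prod_x \alpha_{-x}^{c_x} v_\varnothing$ has squared norm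
  $\prod_x n_x^{c_x} c_x!$; the lemmas below show that this is the inner product
  determined by adjointness.
\<close>

definition mono_normsq :: "mode multiset \<Rightarrow> real" where
  "mono_normsq \<mu> = (\<Prod>x\<in>set_mset \<mu>. real (snd (snd x)) ^ count \<mu> x * fact (count \<mu> x))"

definition fock_inner :: "fock \<Rightarrow> fock \<Rightarrow> real" where
  "fock_inner v w = (\<Sum>\<mu>\<in>Poly_Mapping.keys v.
     Poly_Mapping.lookup v \<mu> * Poly_Mapping.lookup w \<mu> * mono_normsq \<mu>)"

lemma lookup_create:
  "Poly_Mapping.lookup (create x v) \<mu> = (if x \<in># \<mu> then Poly_Mapping.lookup v (\<mu> - {#x#}) else 0)"
proof -
  have "Poly_Mapping.lookup (create x v) \<mu> =
      (\<Sum>\<nu>. Poly_Mapping.lookup (Poly_Mapping.single {#x#} (1::real)) \<nu> *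
         (\<Sum>q. Poly_Mapping.lookup v q when \<mu> = \<nu> + q))"
    by (simp add: create_def lookup_mult)
  also have "\<dots> = (\<Sum>\<nu>. (\<Sum>q. Poly_Mapping.lookup v q when \<mu> = {#x#} + q) when \<nu> = {#x#})"
    by (intro Sum_any.cong) (auto simp: lookup_single when_def)
  also have "\<dots> = (\<Sum>q. Poly_Mapping.lookup v q when \<mu> = {#x#} + q)"
    by simp
  also have "\<dots> = (if x \<in># \<mu> then Poly_Mapping.lookup v (\<mu> - {#x#}) else 0)"
  proof (cases "x \<in># \<mu>")
    case True
    hence "(\<mu> = {#x#} + q) = (q = \<mu> - {#x#})" for q by auto
    thus ?thesis using True by simp
  next
    case False
    hence "(\<mu> = {#x#} + q) = False" for q by auto
    thus ?thesis using False by simp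
  qed
  finally show ?thesis .
qed

lemma alpha_add: "alpha k j m (v + w) = alpha k j m v + alpha k j m w"
  by (rule poly_mapping_eqI)
     (simp add: alpha_def lookup_create annihilate.rep_eq lookup_add algebra_simps)

lemma alpha_scale:
  "alpha k j m (Poly_Mapping.map ((*) c) v) = Poly_Mapping.map ((*) c) (alpha k j m v)"
  by (rule poly_mapping_eqI)
     (simp add: alpha_def lookup_create annihilate.rep_eq map.rep_eq when_def)

lemma create_create: "create x (create y v) = create y (create x v)"
  by (simp add: create_def mult.left_commute)

lemma annihilate_annihilate: "annihilate x (annihilate y v) = annihilate y (annihilate x v)"
proof (cases "x = y")
  case False
  show ?thesis
  proof (rule poly_mapping_eqI)
    fix \<mu>
    have "Poly_Mapping.lookup v (add_mset y (add_mset x \<mu>)) =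
        Poly_Mapping.lookup v (add_mset x (add_mset y \<mu>))"
      by (rule arg_cong[OF add_mset_commute])
    thus "Poly_Mapping.lookup (annihilate x (annihilate y v)) \<mu> =
        Poly_Mapping.lookup (annihilate y (annihilate x v)) \<mu>"
      using False by (simp add: annihilate.rep_eq)
  qed
qed simp

lemma annihilate_create:
  "annihilate x (create y v) = create y (annihilate x v) +
     Poly_Mapping.map ((*) (if x = y then real (snd (snd x)) else 0)) v"
proof (rule poly_mapping_eqI)
  fix \<mu>
  show "Poly_Mapping.lookup (annihilate x (create y v)) \<mu> =
    Poly_Mapping.lookup (create y (annihilate x v) +
      Poly_Mapping.map ((*) (if x = y then real (snd (snd x)) else 0)) v) \<mu>"
  proof (cases "x = y")
    case True
    show ?thesis
    proof (cases "x \<in># \<mu>")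
      case xin: True
      then obtain \<nu> where "\<mu> = add_mset x \<nu>" by (metis insert_DiffM)
      thus ?thesis using True
        by (simp add: annihilate.rep_eq lookup_create lookup_add map.rep_eq when_def ring_distribs)
    next
      case False
      hence "count \<mu> x = 0" by (simp add: not_in_iff)
      thus ?thesis using True False
        by (simp add: annihilate.rep_eq lookup_create lookup_add map.rep_eq when_def)
    qed
  next
    case False
    show ?thesis
    proof (cases "y \<in># \<mu>")
      case yin: True
      then obtain \<nu> where \<nu>: "\<mu> = add_mset y \<nu>" by (metis insert_DiffM)
      have "add_mset x \<mu> - {#y#} = add_mset x \<nu>" using \<nu> False by simp
      thus ?thesis using False \<nu>
        by (simp add: annihilate.rep_eq lookup_create lookup_add map.rep_eq when_def)
    next
      case yout: False
      thus ?thesis using False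
        by (simp add: annihilate.rep_eq lookup_create lookup_add map.rep_eq when_def)
    qed
  qed
qed

lemma alpha_commutator:
  assumes "m \<noteq> 0" "m' \<noteq> 0"
  shows "alpha k j m (alpha k' j' m' v) - alpha k' j' m' (alpha k j m v) =
    Poly_Mapping.map ((*) (if k = k' \<and> j = j' \<and> m = - m' then of_int m else 0)) v"
proof -
  have zero: "Poly_Mapping.map ((*) 0) v = 0"
    by (rule poly_mapping_eqI) (simp add: map.rep_eq)
  have neg: "Poly_Mapping.map ((*) (- c)) v = - Poly_Mapping.map ((*) c) v" for c
    by (rule poly_mapping_eqI) (simp add: map.rep_eq when_def)
  consider "m > 0" "m' > 0" | "m < 0" "m' < 0" | "m > 0" "m' < 0" | "m < 0" "m' > 0"
    using assms by linarith
  thus ?thesis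
  proof cases
    case 1
    thus ?thesis using annihilate_annihilate[of "(k, j, nat m)" "(k', j', nat m')" v]
      by (simp add: alpha_def zero)
  next
    case 2
    thus ?thesis using create_create[of "(k, j, nat (- m))" "(k', j', nat (- m'))" v]
      by (simp add: alpha_def zero)
  next
    case 3
    hence "(nat m = nat (- m')) = (m = - m')" by auto
    thus ?thesis using 3 by (simp add: alpha_def annihilate_create zero)
  next
    case 4
    hence *: "(nat m' = nat (- m)) = (m = - m')" by auto
    have "real (nat m') = - of_int m" if "m = - m'" using 4 that by simp
    thus ?thesis using 4 * neg[of "real (nat m')"] by (auto simp: alpha_def annihilate_create zero)
  qed
qed

lemma alpha_vacuum: "m > 0 \<Longrightarrow> alpha k j m vacuum = 0"
  by (rule poly_mapping_eqI) (simp add: alpha_def vacuum_def annihilate.rep_eq lookup_one)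

text \<open>The monomials in the creation operators applied to the vacuum form the standard basis.\<close>

lemma create_vacuum: "foldr create xs vacuum = Poly_Mapping.single (mset xs) 1"
  by (induction xs) (simp_all add: vacuum_def create_def mult_single)

lemma fock_inner_vacuum: "fock_inner vacuum vacuum = 1"
  by (simp add: fock_inner_def vacuum_def mono_normsq_def)

lemma fock_inner_superset:
  assumes "finite A" "Poly_Mapping.keys v \<inter> Poly_Mapping.keys w \<subseteq> A"
  shows "fock_inner v w =
    (\<Sum>\<mu>\<in>A. Poly_Mapping.lookup v \<mu> * Poly_Mapping.lookup w \<mu> * mono_normsq \<mu>)"
  unfolding fock_inner_def using assms
  by (intro sum.mono_neutral_cong) (auto simp: in_keys_iff)

lemma fock_inner_commute: "fock_inner v w = fock_inner w v"
  using fock_inner_superset[of "Poly_Mapping.keys w" v w]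
  by (simp add: fock_inner_def mult.commute)

lemma fock_inner_add_right: "fock_inner v (w + w') = fock_inner v w + fock_inner v w'"
  by (simp add: fock_inner_def lookup_add algebra_simps sum.distrib)

lemma fock_inner_scale_right: "fock_inner v (Poly_Mapping.map ((*) c) w) = c * fock_inner v w"
  by (auto simp: fock_inner_def map.rep_eq when_def sum_distrib_left intro!: sum.cong)

lemma mono_normsq_add_mset:
  "mono_normsq (add_mset x \<mu>) = real (snd (snd x)) * real (count \<mu> x + 1) * mono_normsq \<mu>"
proof -
  let ?f = "\<lambda>\<mu> y. real (snd (snd y)) ^ count \<mu> y * fact (count \<mu> y) :: real"
  let ?S = "insert x (set_mset \<mu>)"
  have "mono_normsq \<mu> = (\<Prod>y\<in>?S. ?f \<mu> y)"
    unfolding mono_normsq_def by (rule prod.mono_neutral_left) (auto simp: not_in_iff)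
  also have "\<dots> = ?f \<mu> x * (\<Prod>y\<in>?S - {x}. ?f \<mu> y)"
    by (rule prod.remove) auto
  finally have 1: "mono_normsq \<mu> = ?f \<mu> x * (\<Prod>y\<in>?S - {x}. ?f \<mu> y)" .
  have "mono_normsq (add_mset x \<mu>) =
      ?f (add_mset x \<mu>) x * (\<Prod>y\<in>?S - {x}. ?f (add_mset x \<mu>) y)"
    unfolding mono_normsq_def set_mset_add_mset_insert by (rule prod.remove) auto
  also have "(\<Prod>y\<in>?S - {x}. ?f (add_mset x \<mu>) y) = (\<Prod>y\<in>?S - {x}. ?f \<mu> y)"
    by (rule prod.cong) auto
  finally show ?thesis by (simp add: 1 algebra_simps)
qed

lemma fock_inner_annihilate: "fock_inner (annihilate x v) w = fock_inner v (create x w)"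
proof -
  let ?A = "Poly_Mapping.keys w"
  let ?g = "\<lambda>\<mu>. Poly_Mapping.lookup v \<mu> * Poly_Mapping.lookup (create x w) \<mu> * mono_normsq \<mu>"
  have "Poly_Mapping.keys (create x w) \<subseteq> add_mset x ` ?A"
  proof
    fix \<mu> assume "\<mu> \<in> Poly_Mapping.keys (create x w)"
    hence "x \<in># \<mu>" "\<mu> - {#x#} \<in> ?A"
      by (auto simp: in_keys_iff lookup_create split: if_splits)
    thus "\<mu> \<in> add_mset x ` ?A" by (metis image_eqI insert_DiffM)
  qed
  hence "fock_inner v (create x w) = sum ?g (add_mset x ` ?A)"
    by (intro fock_inner_superset) auto
  also have "\<dots> = (\<Sum>\<mu>\<in>?A. ?g (add_mset x \<mu>))"
    by (simp add: sum.reindex inj_on_def)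
  also have "\<dots> = fock_inner (annihilate x v) w"
    by (subst fock_inner_superset[of ?A])
       (auto simp: lookup_create annihilate.rep_eq mono_normsq_add_mset algebra_simps)
  finally show ?thesis by simp
qed

lemma alpha_adjoint: "fock_inner (alpha k j m v) w = fock_inner v (alpha k j (- m) w)"
proof (cases m "0 :: int" rule: linorder_cases)
  case less
  have "fock_inner (create (k, j, nat (- m)) v) w = fock_inner w (create (k, j, nat (- m)) v)"
    by (rule fock_inner_commute)
  also have "\<dots> = fock_inner (annihilate (k, j, nat (- m)) w) v"
    by (rule fock_inner_annihilate[symmetric])
  also have "\<dots> = fock_inner v (annihilate (k, j, nat (- m)) w)"
    by (rule fock_inner_commute)
  finally show ?thesis using less by (simp add: alpha_def)
qed (simp_all add: alpha_def fock_inner_annihilate)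

lemma alpha_fock_space:
  assumes "v \<in> fock_space r a" "k \<in> {1..r}" "j \<in> {1..a k + 1}"
  shows "alpha k j m v \<in> fock_space r a"
proof -
  have "set_mset \<mu> \<subseteq> modes r a" if \<mu>: "\<mu> \<in> Poly_Mapping.keys (alpha k j m v)" for \<mu>
  proof (cases m "0 :: int" rule: linorder_cases)
    case less
    let ?x = "(k, j, nat (- m))"
    have "?x \<in># \<mu>" "\<mu> - {#?x#} \<in> Poly_Mapping.keys v"
      using \<mu> less by (auto simp: alpha_def in_keys_iff lookup_create split: if_splits)
    moreover have "?x \<in> modes r a" using assms less by (simp add: modes_def)
    ultimately have "set_mset (add_mset ?x (\<mu> - {#?x#})) \<subseteq> modes r a"
      using assms(1) unfolding fock_space_def set_mset_add_mset_insert by blast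
    thus ?thesis using \<open>?x \<in># \<mu>\<close> by (simp only: insert_DiffM)
  next
    case greater
    have "add_mset (k, j, nat m) \<mu> \<in> Poly_Mapping.keys v"
      using \<mu> greater by (auto simp: alpha_def in_keys_iff annihilate.rep_eq)
    hence "set_mset (add_mset (k, j, nat m) \<mu>) \<subseteq> modes r a"
      using assms(1) unfolding fock_space_def by blast
    thus ?thesis by simp
  qed (use assms(1) \<mu> in \<open>auto simp: alpha_def fock_space_def\<close>)
  thus ?thesis by (simp add: fock_space_def)
qed


section \<open>The labeled cut-join operator\<close>

text \<open>
  The edges adjacent to the vertex are \<open>q 1\<close>, \<open>q 2\<close> and \<open>q 3\<close>. The sum over all triples of
  integers is a finite sum when applied to a vector: only finitely many terms are nonzero,
  and \<open>Sum_any\<close> adds these up.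
\<close>

definition cut_join_slot :: "(nat \<Rightarrow> nat) \<Rightarrow> (nat \<Rightarrow> nat) \<Rightarrow> nat \<Rightarrow> int \<Rightarrow> nat" where
  "cut_join_slot a w k m = (if m > 0 then (if a k > 0 then a k div w k + 1 else 1) else 1)"

definition cut_join_term ::
  "(nat \<Rightarrow> nat) \<Rightarrow> (nat \<Rightarrow> nat) \<Rightarrow> (nat \<Rightarrow> nat) \<Rightarrow> int \<Rightarrow> int \<Rightarrow> int \<Rightarrow> fock \<Rightarrow> fock" where
  "cut_join_term a w q m\<^sub>1 m\<^sub>2 m\<^sub>3 =
     alpha (q 1) (cut_join_slot a w (q 1) m\<^sub>1) m\<^sub>1 \<circ>
     alpha (q 2) (cut_join_slot a w (q 2) m\<^sub>2) m\<^sub>2 \<circ>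
     alpha (q 3) (cut_join_slot a w (q 3) m\<^sub>3) m\<^sub>3"

definition cut_join :: "(nat \<Rightarrow> nat) \<Rightarrow> (nat \<Rightarrow> nat) \<Rightarrow> (nat \<Rightarrow> nat) \<Rightarrow> fock \<Rightarrow> fock" where
  "cut_join a w q v =
     Sum_any (\<lambda>(m\<^sub>1, m\<^sub>2, m\<^sub>3). cut_join_term a w q m\<^sub>1 m\<^sub>2 m\<^sub>3 v
       when m\<^sub>1 \<noteq> 0 \<and> m\<^sub>2 \<noteq> 0 \<and> m\<^sub>3 \<noteq> 0 \<and> m\<^sub>1 + m\<^sub>2 + m\<^sub>3 = 0)"

definition energies :: "fock \<Rightarrow> nat \<Rightarrow> nat set" where
  "energies v k = {n. \<exists>\<mu>\<in>Poly_Mapping.keys v. \<exists>j. (k, j, n) \<in># \<mu>}"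

lemma finite_energies: "finite (energies v k)"
proof -
  have "energies v k \<subseteq> (\<Union>\<mu>\<in>Poly_Mapping.keys v. (snd \<circ> snd) ` set_mset \<mu>)"
    by (force simp: energies_def)
  thus ?thesis by (rule finite_subset) auto
qed

lemma energies_alpha:
  assumes "k \<noteq> k'"
  shows "energies (alpha k' j m v) k \<subseteq> energies v k"
proof
  fix n assume "n \<in> energies (alpha k' j m v) k"
  then obtain \<mu> i where \<mu>: "\<mu> \<in> Poly_Mapping.keys (alpha k' j m v)" "(k, i, n) \<in># \<mu>"
    by (auto simp: energies_def)
  show "n \<in> energies v k"
  proof (cases m "0 :: int" rule: linorder_cases)
    case less
    hence "\<mu> - {#(k', j, nat (- m))#} \<in> Poly_Mapping.keys v"
      using \<mu> by (auto simp: alpha_def in_keys_iff lookup_create split: if_splits)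
    moreover have "(k, i, n) \<in># \<mu> - {#(k', j, nat (- m))#}"
      using \<mu>(2) assms by (simp add: in_diff_count)
    ultimately show ?thesis by (auto simp: energies_def)
  next
    case greater
    hence "add_mset (k', j, nat m) \<mu> \<in> Poly_Mapping.keys v"
      using \<mu> by (auto simp: alpha_def in_keys_iff annihilate.rep_eq)
    moreover have "(k, i, n) \<in># add_mset (k', j, nat m) \<mu>"
      using \<mu>(2) by simp
    ultimately show ?thesis unfolding energies_def by blast
  qed (use \<mu> in \<open>auto simp: alpha_def energies_def\<close>)
qed

lemma alpha_eq_zero:
  assumes "m > 0" "nat m \<notin> energies v k"
  shows "alpha k j m v = 0"
proof (rule poly_mapping_eqI)
  fix \<mu>
  have "add_mset (k, j, nat m) \<mu> \<notin> Poly_Mapping.keys v"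
    using assms(2) unfolding energies_def by force
  thus "Poly_Mapping.lookup (alpha k j m v) \<mu> = Poly_Mapping.lookup 0 \<mu>"
    using assms(1) by (simp add: alpha_def annihilate.rep_eq in_keys_iff)
qed

lemma alpha_zero: "alpha k j m 0 = 0"
  by (rule poly_mapping_eqI) (simp add: alpha_def lookup_create annihilate.rep_eq)

text \<open>Well-definedness of the cut-join operator.\<close>

lemma finite_cut_join:
  assumes "q 1 \<noteq> q 2" "q 1 \<noteq> q 3" "q 2 \<noteq> q 3"
  shows "finite {(m\<^sub>1, m\<^sub>2, m\<^sub>3). cut_join_term a w q m\<^sub>1 m\<^sub>2 m\<^sub>3 v \<noteq> 0 \<and>
    m\<^sub>1 \<noteq> 0 \<and> m\<^sub>2 \<noteq> 0 \<and> m\<^sub>3 \<noteq> 0 \<and> m\<^sub>1 + m\<^sub>2 + m\<^sub>3 = 0}"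
proof -
  define E where "E = energies v (q 1) \<union> energies v (q 2) \<union> energies v (q 3)"
  define B where "B = int (Max (insert 0 E))"
  have "finite E" by (simp add: E_def finite_energies)
  hence fin: "finite (insert 0 E)" by simp
  have "B \<ge> 0" by (simp add: B_def)
  have B: "m \<le> B" if "m > 0 \<Longrightarrow> nat m \<in> E" for m
  proof (cases "m > 0")
    case True
    hence "nat m \<le> Max (insert 0 E)" using fin that by (intro Max_ge) auto
    thus ?thesis unfolding B_def by linarith
  qed (use \<open>B \<ge> 0\<close> in linarith)
  have "\<bar>m\<^sub>1\<bar> \<le> 2 * B \<and> \<bar>m\<^sub>2\<bar> \<le> 2 * B \<and> \<bar>m\<^sub>3\<bar> \<le> 2 * B"
    if nz: "cut_join_term a w q m\<^sub>1 m\<^sub>2 m\<^sub>3 v \<noteq> 0" and sum: "m\<^sub>1 + m\<^sub>2 + m\<^sub>3 = 0" for m\<^sub>1 m\<^sub>2 m\<^sub>3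
  proof -
    let ?A = "\<lambda>k m. alpha k (cut_join_slot a w k m) m"
    have *: "?A (q 1) m\<^sub>1 (?A (q 2) m\<^sub>2 (?A (q 3) m\<^sub>3 v)) \<noteq> 0"
      using nz by (simp add: cut_join_term_def)
    have "m\<^sub>3 \<le> B"
    proof (rule B)
      assume "m\<^sub>3 > 0"
      hence "nat m\<^sub>3 \<in> energies v (q 3)"
        using * alpha_eq_zero alpha_zero by metis
      thus "nat m\<^sub>3 \<in> E" by (simp add: E_def)
    qed
    moreover have "m\<^sub>2 \<le> B"
    proof (rule B)
      assume "m\<^sub>2 > 0"
      hence "nat m\<^sub>2 \<in> energies (?A (q 3) m\<^sub>3 v) (q 2)"
        using * alpha_eq_zero alpha_zero by metis
      thus "nat m\<^sub>2 \<in> E" using energies_alpha[OF assms(3)] by (auto simp: E_def)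
    qed
    moreover have "m\<^sub>1 \<le> B"
    proof (rule B)
      assume "m\<^sub>1 > 0"
      hence "nat m\<^sub>1 \<in> energies (?A (q 2) m\<^sub>2 (?A (q 3) m\<^sub>3 v)) (q 1)"
        using * alpha_eq_zero by metis
      thus "nat m\<^sub>1 \<in> E"
        using energies_alpha[OF assms(1)] energies_alpha[OF assms(2)] unfolding E_def by blast
    qed
    ultimately show ?thesis using sum by linarith
  qed
  note bound = this
  have "{(m\<^sub>1, m\<^sub>2, m\<^sub>3). cut_join_term a w q m\<^sub>1 m\<^sub>2 m\<^sub>3 v \<noteq> 0 \<and>
      m\<^sub>1 \<noteq> 0 \<and> m\<^sub>2 \<noteq> 0 \<and> m\<^sub>3 \<noteq> 0 \<and> m\<^sub>1 + m\<^sub>2 + m\<^sub>3 = 0} \<subseteq>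
    {- 2 * B..2 * B} \<times> {- 2 * B..2 * B} \<times> {- 2 * B..2 * B}"
  proof (clarify, goal_cases)
    case (1 m\<^sub>1 m\<^sub>2 m\<^sub>3)
    from bound[OF 1(1) 1(5)] show ?case by auto
  qed
  thus ?thesis by (rule finite_subset) auto
qed


section \<open>Matrix elements\<close>

text \<open>Ordered products of operators: the last factor of the list is applied first.\<close>

definition op_prod :: "(fock \<Rightarrow> fock) list \<Rightarrow> fock \<Rightarrow> fock" where
  "op_prod As = foldr (\<circ>) As id"

definition matrix_element :: "fock \<Rightarrow> (fock \<Rightarrow> fock) \<Rightarrow> fock \<Rightarrow> real" where
  "matrix_element v A w = fock_inner v (A w)"

text \<open>
  For \<open>a k = 0\<close> the value \<open>w k\<close> is irrelevant in the following, as \<open>0 div w k = 0\<close>.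
\<close>

definition left_state :: "nat \<Rightarrow> (nat \<Rightarrow> nat) \<Rightarrow> (nat \<Rightarrow> nat) \<Rightarrow> fock" where
  "left_state r a w =
     op_prod [alpha k l (- int (w k)). k \<leftarrow> [1..<r + 1], l \<leftarrow> [1..<a k div w k + 1]] vacuum"

definition right_state :: "nat \<Rightarrow> (nat \<Rightarrow> nat) \<Rightarrow> (nat \<Rightarrow> nat) \<Rightarrow> fock" where
  "right_state r a w =
     op_prod [alpha k l (- int (w k)). k \<leftarrow> [1..<r + 1], l \<leftarrow> [2..<a k div w k + 2]] vacuum"

text \<open>The tuples $(w_k)_{k : a_k > 0}$ of positive integers with $w_k \mid a_k$.\<close>

definition divisor_tuples :: "nat \<Rightarrow> (nat \<Rightarrow> nat) \<Rightarrow> (nat \<Rightarrow> nat) set" where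
  "divisor_tuples r a = (\<Pi>\<^sub>E k\<in>{k\<in>{1..r}. a k > 0}. {d. d > 0 \<and> d dvd a k})"

end

theory Submission
  imports Defs
begin

text \<open>
  Orient every edge $q_k$ from \<open>lo k\<close> to \<open>hi k\<close>. Up to isomorphism a cover is the same as a
  nowhere zero integer flow \<open>m\<close> on the graph: \<open>\<bar>m k\<bar>\<close> is the expansion factor, the sign tells
  whether the edge runs along the orientation of the circle, and balancing is conservation.
  The degree condition says that the edge passes $p_0$ exactly $a_k / |m_k|$ times, which fixes its
  length; if $a_k = 0$ it forces the edge to run from its earlier to its later vertex.

  On the other side, expanding the product of the cut-join operators chooses an integer for every
  flag, with sum zero at every vertex. The matrix element of such a choice factors over the edges,
  because operators with different \<open>k\<close> commute. The factor of $q_k$ vanishes unless its two integers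
  are opposite, equal to $\pm w_k$ if $a_k > 0$, and created before annihilated if $a_k = 0$; after
  normalization it is then $|m_k|$. The surviving choices are exactly the flows above.
\<close>

section \<open>Paths in the circle\<close>

text \<open>The slots of the two vectors record how an edge is cut at p_0. If it passes p_0 exactly
  c = a_k / w_k > 0 times, the cut leaves c + 1 pieces: slots 2, ..., c run from the right vector to
  the left one without meeting a vertex, slot c + 1 of the right vector is absorbed at one end of
  the edge, and slot 1 of the left vector is emitted at the other. As 1 and c + 1 differ, the two
  vertex operators act on different modes and may come in either order, just as a winding edge may
  run in either direction. If c = 0, both operators use slot 1 and their order decides. No bound on
  the flows is visible at the start: if a_k = 0, the edge itself does not restrict the size of m_k,
  and each cut-join operator is an infinite sum. The expansion is therefore truncated at a bound B
  and proved for all large B, and finiteness of the set of flows comes out only at the end. Until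
  then sums over flows are moved along bijections, which respect the convention that a sum over an
  infinite set is 0.\<close>

lemma circle_pt_eq_iff: "circle_pt L x = circle_pt L y \<longleftrightarrow> (\<exists>z::int. x = y + of_int z * L)"
proof
  assume "circle_pt L x = circle_pt L y"
  hence "[x = y] (rmod L)"
    unfolding circle_pt_def by (metis mem_Collect_eq rcong_refl)
  thus "\<exists>z::int. x = y + of_int z * L"
    using rcong_altdef rcong_sym_iff by blast
next
  assume "\<exists>z::int. x = y + of_int z * L"
  hence "[y = x] (rmod L)"
    by (simp add: rcong_altdef)
  thus "circle_pt L x = circle_pt L y"
    unfolding circle_pt_def by (metis (no_types) rcong_sym rcong_trans)
qed

lemma circle_pt_add_period: "circle_pt L (x + of_int z * L) = circle_pt L x"
  by (auto simp: circle_pt_eq_iff)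

lemma circle_pt_shift:
  assumes "circle_pt L x = circle_pt L y"
  shows "circle_pt L (x + t) = circle_pt L (y + t)"
  using assms unfolding circle_pt_eq_iff by (auto simp: algebra_simps)

text \<open>Two lifts of one path differ by a multiple of the period at every time, and this
  multiple cannot change while the lifts drift apart by at most \<open>L / 2\<close>.\<close>

lemma circle_path_slope_unique:
  assumes "L > 0" "\<epsilon> > 0"
    and "\<And>t. t \<in> {0..\<epsilon>} \<Longrightarrow> circle_pt L (b + x * t) = circle_pt L (c + y * t)"
  shows "x = y"
proof (rule ccontr)
  assume ne: "x \<noteq> y"
  define t where "t = min \<epsilon> (L / (2 * \<bar>x - y\<bar>))"
  have t: "t \<in> {0..\<epsilon>}" "t > 0" "t \<le> L / (2 * \<bar>x - y\<bar>)"
    using assms(1,2) ne by (auto simp: t_def)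
  obtain z0 where z0: "b = c + of_int z0 * L"
    using assms(3)[of 0] assms(2) by (auto simp: circle_pt_eq_iff)
  obtain z1 where z1: "b + x * t = c + y * t + of_int z1 * L"
    using assms(3)[OF t(1)] by (auto simp: circle_pt_eq_iff)
  have "(x - y) * t = of_int (z1 - z0) * L"
    using z0 z1 by (simp add: algebra_simps)
  hence eq: "\<bar>x - y\<bar> * t = of_int \<bar>z1 - z0\<bar> * L"
    using \<open>L > 0\<close> t(2) by (metis abs_mult abs_of_pos of_int_abs)
  have pos: "0 < \<bar>x - y\<bar> * t" using ne t(2) by simp
  have "\<bar>x - y\<bar> * t \<le> L / 2"
    using t(3) ne by (simp add: field_simps)
  hence "of_int \<bar>z1 - z0\<bar> * L < 1 * L" using eq \<open>L > 0\<close> by simp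
  hence "\<bar>z1 - z0\<bar> < 1"
    using \<open>L > 0\<close> by (metis mult_less_cancel_right_pos of_int_less_1_iff)
  hence "\<bar>x - y\<bar> * t = 0" using eq by simp
  thus False using pos by linarith
qed

text \<open>On the real line the path climbs from \<open>\<alpha>\<close> to
  \<open>\<beta> + z * L\<close>. Both \<open>\<alpha>\<close> and \<open>\<beta>\<close> lie
  strictly inside the same period window, so the lifts of \<open>p\<close> on the way are
  \<open>p + j * L\<close> for \<open>j\<close> from 1 to \<open>z\<close>, each met once.\<close>

lemma card_crossings_pos:
  assumes L: "L > 0" and \<alpha>: "p < \<alpha>" "\<alpha> < p + L" and \<beta>: "p < \<beta>" "\<beta> < p + L"
    and m: "m > 0" and l: "l > 0" and closing: "\<alpha> + m * l = \<beta> + of_int z * L"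
  shows "z \<ge> 0" "card {t \<in> {0..l}. circle_pt L (\<alpha> + m * t) = circle_pt L p} = nat z"
proof -
  have "m * l > 0" using m l by simp
  \<comment> \<open>The rise is positive and \<open>\<beta> - \<alpha>\<close> is less than one
    period.\<close>
  hence "of_int z * L > (-1) * L" using closing \<alpha> \<beta> by simp
  hence "real_of_int z > -1" using L by (metis mult_less_cancel_right_pos)
  thus "z \<ge> 0" by linarith
  \<comment> \<open>The time at which the lift reaches \<open>p + j * L\<close>.\<close>
  define T where "T j = (p + of_int j * L - \<alpha>) / m" for j :: int
  have "bij_betw T {1..z} {t \<in> {0..l}. circle_pt L (\<alpha> + m * t) = circle_pt L p}"
  proof (rule bij_betwI')
    fix j j' assume "j \<in> {1..z}" "j' \<in> {1..z}"
    show "(T j = T j') = (j = j')" using m L by (simp add: T_def)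
  next
    fix j assume j: "j \<in> {1..z}"
    have "1 * L \<le> of_int j * L" "of_int j * L \<le> of_int z * L"
      using j L by (intro mult_right_mono; simp)+
    hence "0 \<le> p + of_int j * L - \<alpha>" "p + of_int j * L - \<alpha> \<le> m * l"
      using \<alpha> \<beta> closing by linarith+
    hence "T j \<in> {0..l}" using m by (simp add: T_def pos_divide_le_eq mult.commute)
    moreover have "\<alpha> + m * T j = p + of_int j * L" using m by (simp add: T_def)
    ultimately show "T j \<in> {t \<in> {0..l}. circle_pt L (\<alpha> + m * t) = circle_pt L p}"
      by (simp add: circle_pt_add_period)
  next
    fix t assume t: "t \<in> {t \<in> {0..l}. circle_pt L (\<alpha> + m * t) = circle_pt L p}"
    then obtain j where j: "\<alpha> + m * t = p + of_int j * L" by (auto simp: circle_pt_eq_iff)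
    have bounds: "0 \<le> m * t" "m * t \<le> m * l" using t m by auto
    have "of_int j * L > 0 * L" using j bounds \<alpha> by simp
    hence "real_of_int j > 0" using L by (metis mult_less_cancel_right_pos)
    moreover have "of_int j * L < (of_int z + 1) * L"
      using j bounds closing \<beta> by (simp add: algebra_simps)
    hence "real_of_int j < of_int z + 1" using L by (metis mult_less_cancel_right_pos)
    ultimately have "j \<in> {1..z}" by auto
    moreover have "t = T j" using j m by (simp add: T_def field_simps)
    ultimately show "\<exists>j\<in>{1..z}. t = T j" by blast
  qed
  hence "card {t \<in> {0..l}. circle_pt L (\<alpha> + m * t) = circle_pt L p} = card {1..z}"
    by (rule bij_betw_same_card[symmetric])
  thus "card {t \<in> {0..l}. circle_pt L (\<alpha> + m * t) = circle_pt L p} = nat z" by simp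
qed

text \<open>Traversing the segment backwards reduces a negative slope to a positive one.\<close>

lemma card_crossings:
  assumes L: "L > 0" and \<alpha>: "p < \<alpha>" "\<alpha> < p + L" and \<beta>: "p < \<beta>" "\<beta> < p + L"
    and m: "m \<noteq> 0" and l: "l > 0" and closing: "\<alpha> + of_int m * l = \<beta> + of_int z * L"
  shows "int (card {t \<in> {0..l}. circle_pt L (\<alpha> + of_int m * t) = circle_pt L p}) = sgn m * z"
proof (cases "m > 0")
  case True
  thus ?thesis
    using card_crossings_pos[of L p \<alpha> \<beta> "of_int m" l z] assms by simp
next
  case False
  hence m': "real_of_int (- m) > 0" using m by simp
  have "\<beta> + of_int (- m) * l = \<alpha> + of_int (- z) * L" using closing by simp
  note rev = card_crossings_pos[OF L \<beta> \<alpha> m' l this]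
  have pt: "circle_pt L (\<beta> + of_int (- m) * t) = circle_pt L (\<alpha> + of_int m * (l - t))" for t
  proof -
    have "\<alpha> + of_int m * (l - t) = (\<beta> + of_int (- m) * t) + of_int z * L"
      using closing by (simp add: algebra_simps)
    thus ?thesis by (simp only: circle_pt_add_period)
  qed
  have "{t \<in> {0..l}. circle_pt L (\<alpha> + of_int m * t) = circle_pt L p} =
      (\<lambda>t. l - t) ` {t \<in> {0..l}. circle_pt L (\<beta> + of_int (- m) * t) = circle_pt L p}"
  proof (intro set_eqI iffI)
    fix t assume "t \<in> {t \<in> {0..l}. circle_pt L (\<alpha> + of_int m * t) = circle_pt L p}"
    thus "t \<in> (\<lambda>t. l - t) ` {t \<in> {0..l}. circle_pt L (\<beta> + of_int (- m) * t) = circle_pt L p}"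
      using pt[of "l - t"] by (intro image_eqI[of _ _ "l - t"]) auto
  next
    fix t assume "t \<in> (\<lambda>t. l - t) ` {t \<in> {0..l}. circle_pt L (\<beta> + of_int (- m) * t) = circle_pt L p}"
    then obtain s where "t = l - s" "s \<in> {0..l}" "circle_pt L (\<beta> + of_int (- m) * s) = circle_pt L p"
      by blast
    thus "t \<in> {t \<in> {0..l}. circle_pt L (\<alpha> + of_int m * t) = circle_pt L p}"
      using pt[of s] by auto
  qed
  also have "card \<dots> = card {t \<in> {0..l}. circle_pt L (\<beta> + of_int (- m) * t) = circle_pt L p}"
    by (rule card_image) (simp add: inj_on_def)
  finally have "card {t \<in> {0..l}. circle_pt L (\<alpha> + of_int m * t) = circle_pt L p} =
      card {t \<in> {0..l}. circle_pt L (\<beta> + of_int (- m) * t) = circle_pt L p}" .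
  thus ?thesis unfolding rev(2) using rev(1) False m by (simp add: sgn_if)
qed


section \<open>Covers and flows\<close>

text \<open>The relation is equality of \<open>h\<close>, so its classes are the nonempty fibres of
  \<open>h\<close>.\<close>

lemma bij_betw_quotient_fibres:
  assumes "equiv S R" and "\<And>x y. x \<in> S \<Longrightarrow> y \<in> S \<Longrightarrow> (x, y) \<in> R \<longleftrightarrow> h x = h y"
  shows "bij_betw (\<lambda>t. {x \<in> S. h x = t}) (h ` S) (S // R)"
proof (rule bij_betwI')
  fix s t assume "s \<in> h ` S" "t \<in> h ` S"
  thus "({x \<in> S. h x = s} = {x \<in> S. h x = t}) = (s = t)" by blast
next
  have cls: "R `` {x} = {y \<in> S. h y = h x}" if "x \<in> S" for x
    using that assms(2) equiv_class_subset[OF assms(1)] assms(1)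
    by (auto dest: equivE simp: equiv_def)
  show "{x \<in> S. h x = t} \<in> S // R" if "t \<in> h ` S" for t
    using that cls by (auto intro!: quotientI simp flip: cls)
  show "\<exists>t\<in>h ` S. C = {x \<in> S. h x = t}" if "C \<in> S // R" for C
    using that cls by (auto elim!: quotientE)
qed

text \<open>\<open>f\<close> is constant on each fibre, so \<open>the_elem\<close> returns its value
  there. The reindexing is valid for infinitely many classes as well.\<close>

lemma sum_quotient_fibres:
  assumes "equiv S R" and "\<And>x y. x \<in> S \<Longrightarrow> y \<in> S \<Longrightarrow> (x, y) \<in> R \<longleftrightarrow> h x = h y"
    and "\<And>x. x \<in> S \<Longrightarrow> f x = g (h x)"
  shows "(\<Sum>C\<in>S // R. the_elem (f ` C)) = sum g (h ` S)"
proof -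
  have "sum g (h ` S) = (\<Sum>t\<in>h ` S. the_elem (f ` {x \<in> S. h x = t}))"
  proof (rule sum.cong)
    fix t assume "t \<in> h ` S"
    hence "f ` {x \<in> S. h x = t} = {g t}" using assms(3) by auto
    thus "g t = the_elem (f ` {x \<in> S. h x = t})" by simp
  qed simp
  also have "\<dots> = (\<Sum>C\<in>S // R. the_elem (f ` C))"
    using bij_betw_quotient_fibres[OF assms(1,2)] by (rule sum.reindex_bij_betw)
  finally show ?thesis by simp
qed

section \<open>Vertex positions and signed slopes\<close>

text \<open>Covers are treated for arbitrary valence; \<open>no_isolated\<close> ensures that
  conservation at a vertex provides edges in both directions of the circle.\<close>

locale circle_graph =
  fixes L :: real and P :: "nat \<Rightarrow> real" and n r :: nat and ends :: "nat \<Rightarrow> nat set"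
    and a :: "nat \<Rightarrow> nat" and \<Omega> :: "nat \<Rightarrow> nat"
  assumes L_pos: "L > 0" and P_mono: "strict_mono_on {0..n} P" and P_period: "P n < P 0 + L"
    and graph: "feynman_graph n r ends" and loopless: "loopless r ends"
    and no_isolated: "\<And>i. i \<in> {1..n} \<Longrightarrow> \<exists>k\<in>{1..r}. i \<in> ends k"
    and order: "\<Omega> permutes {1..n}"
begin

abbreviation lo :: "nat \<Rightarrow> nat" where "lo k \<equiv> Min (ends k)"
abbreviation hi :: "nat \<Rightarrow> nat" where "hi k \<equiv> Max (ends k)"
abbreviation pos :: "nat \<Rightarrow> real" where "pos i \<equiv> P (\<Omega> i)"
abbreviation star :: "nat \<Rightarrow> nat set" where "star i \<equiv> {k \<in> {1..r}. i \<in> ends k}"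

lemma ends:
  assumes "k \<in> {1..r}"
  shows "lo k < hi k" "i \<in> ends k \<longleftrightarrow> i = lo k \<or> i = hi k" "lo k \<in> {1..n}" "hi k \<in> {1..n}"
proof -
  have "ends k \<subseteq> {1..n}" "card (ends k) = 2"
    using graph loopless assms unfolding feynman_graph_def loopless_def by auto
  then obtain x y where xy: "ends k = {x, y}" "x \<noteq> y" "x \<in> {1..n}" "y \<in> {1..n}"
    by (auto simp: card_2_iff)
  thus "lo k < hi k" "i \<in> ends k \<longleftrightarrow> i = lo k \<or> i = hi k" "lo k \<in> {1..n}" "hi k \<in> {1..n}"
    by (auto simp: min_def max_def)
qed

lemma Omega_mem: "i \<in> {1..n} \<Longrightarrow> \<Omega> i \<in> {1..n}"
  using permutes_in_image[OF order] by blast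

lemma pos_bounds:
  assumes "i \<in> {1..n}"
  shows "P 0 < pos i" "pos i < P 0 + L"
proof -
  have i: "\<Omega> i \<in> {1..n}" using Omega_mem[OF assms] .
  show "P 0 < pos i" using P_mono i by (auto simp: strict_mono_on_def)
  have "pos i \<le> P n"
    using P_mono i by (cases "\<Omega> i = n") (auto simp: strict_mono_on_def less_imp_le)
  thus "pos i < P 0 + L" using P_period by simp
qed

lemma pos_less_iff:
  assumes "i \<in> {1..n}" "j \<in> {1..n}"
  shows "pos i < pos j \<longleftrightarrow> \<Omega> i < \<Omega> j"
proof -
  have "\<Omega> i \<in> {0..n}" "\<Omega> j \<in> {0..n}"
    using Omega_mem[OF assms(1)] Omega_mem[OF assms(2)] by auto
  thus ?thesis by (rule strict_mono_on_less[OF P_mono])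
qed

text \<open>The ends of an edge are distinct vertices, so points of the edge can be counted by their
  parameters.\<close>

lemma inj_edge_point:
  assumes "k \<in> {1..r}"
  shows "inj_on (edge_point ends len k) {0..len k}"
  using ends(1)[OF assms] by (auto simp: inj_on_def edge_point_def split: if_splits)

text \<open>The base point, free in \<open>is_cover\<close>, is pinned to the position of the lower
  end, so that a single signed integer describes the map on the edge.\<close>

definition edge_affine :: "(nat \<Rightarrow> real) \<Rightarrow> (gpoint \<Rightarrow> real set) \<Rightarrow> nat \<Rightarrow> int \<Rightarrow> bool" where
  "edge_affine len \<pi> k m \<longleftrightarrow>
     (\<forall>t\<in>{0..len k}. \<pi> (edge_point ends len k t) = circle_pt L (pos (lo k) + of_int m * t))"

lemma edge_affineD:
  "edge_affine len \<pi> k m \<Longrightarrow> 0 \<le> t \<Longrightarrow> t \<le> len k \<Longrightarrow>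
    \<pi> (edge_point ends len k t) = circle_pt L (pos (lo k) + of_int m * t)"
  by (simp add: edge_affine_def)

text \<open>Positive when the edge leaves \<open>i\<close> along the orientation of the circle;
  meaningful for edges in \<open>star i\<close> only.\<close>

definition outflow :: "(nat \<Rightarrow> int) \<Rightarrow> nat \<Rightarrow> nat \<Rightarrow> int" where
  "outflow m i k = (if i = lo k then m k else - m k)"

definition conserved :: "(nat \<Rightarrow> int) \<Rightarrow> bool" where
  "conserved m \<longleftrightarrow> (\<forall>i\<in>{1..n}. (\<Sum>k\<in>star i. outflow m i k) = 0)"

text \<open>
  \<open>m k\<close> is the expansion factor of the edge \<open>k\<close>, with a sign that tells whether
  the edge, traversed from \<open>lo k\<close> to \<open>hi k\<close>, follows the orientation of the circle.
\<close>

definition cover_slope :: "cover \<Rightarrow> (nat \<Rightarrow> int) \<Rightarrow> bool" where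
  "cover_slope c m \<longleftrightarrow> (case c of (len, \<omega>, \<pi>) \<Rightarrow>
     (\<forall>k\<in>{1..r}. len k > 0 \<and> m k \<noteq> 0 \<and> \<omega> k = nat \<bar>m k\<bar> \<and> edge_affine len \<pi> k (m k)))"

lemma edge_affine_unique:
  assumes "edge_affine len \<pi> k m" "edge_affine len \<pi> k m'" "len k > 0"
  shows "m = m'"
proof -
  have "real_of_int m = real_of_int m'"
    by (rule circle_path_slope_unique[OF L_pos assms(3), of "pos (lo k)" _ "pos (lo k)"])
       (use assms(1,2) in \<open>auto simp: edge_affine_def\<close>)
  thus ?thesis by simp
qed

lemma cover_slope_unique:
  assumes "cover_slope c m" "cover_slope c m'" "k \<in> {1..r}"
  shows "m k = m' k"
  using assms edge_affine_unique by (cases c) (force simp: cover_slope_def)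

lemma cover_slope_exists:
  assumes "is_cover L P n r ends a \<Omega> c"
  obtains m where "m \<in> extensional {1..r}" "cover_slope c m"
proof -
  obtain len \<omega> \<pi> where c: "c = (len, \<omega>, \<pi>)" by (cases c)
  note cov = assms[unfolded is_cover_def c prod.case]
  have "\<exists>m. len k > 0 \<and> m \<noteq> 0 \<and> \<omega> k = nat \<bar>m\<bar> \<and> edge_affine len \<pi> k m"
    if k: "k \<in> {1..r}" for k
  proof -
    have pos: "len k > 0" "\<omega> k > 0" using cov k by auto
    obtain b s where s: "s \<in> {1, -1 :: real}" and
      b: "\<And>t. t \<in> {0..len k} \<Longrightarrow> \<pi> (edge_point ends len k t) = circle_pt L (b + s * real (\<omega> k) * t)"
      using cov k by metis
    have "\<pi> (Vertex (lo k)) = circle_pt L (pos (lo k))"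
      using cov ends(3)[OF k] by blast
    hence b0: "circle_pt L b = circle_pt L (pos (lo k))"
      using b[of 0] pos by (simp add: edge_point_def)
    define m where "m = (if s = 1 then int (\<omega> k) else - int (\<omega> k))"
    have sm: "s * real (\<omega> k) = of_int m" using s by (auto simp: m_def)
    have "edge_affine len \<pi> k m"
      unfolding edge_affine_def using b circle_pt_shift[OF b0] by (simp add: sm)
    moreover have "m \<noteq> 0" "\<omega> k = nat \<bar>m\<bar>" using pos by (auto simp: m_def)
    ultimately show ?thesis using pos by blast
  qed
  then obtain m where "\<forall>k\<in>{1..r}. len k > 0 \<and> m k \<noteq> 0 \<and> \<omega> k = nat \<bar>m k\<bar> \<and> edge_affine len \<pi> k (m k)"
    by metis
  \<comment> \<open>Restricted to the edges, the slope is unique as a function.\<close>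
  hence "cover_slope c (restrict m {1..r})"
    by (simp add: cover_slope_def c)
  thus ?thesis using that by blast
qed

text \<open>\<open>z\<close> is the winding number of the edge, read off at its upper end.\<close>

lemma edge_closing:
  assumes "cover_slope (len, \<omega>, \<pi>) m" "\<And>i. i \<in> {1..n} \<Longrightarrow> \<pi> (Vertex i) = circle_pt L (pos i)"
    and k: "k \<in> {1..r}"
  obtains z :: int where "pos (lo k) + of_int (m k) * len k = pos (hi k) + of_int z * L"
proof -
  have "len k > 0" "edge_affine len \<pi> k (m k)"
    using assms(1) k by (auto simp: cover_slope_def)
  hence "circle_pt L (pos (lo k) + of_int (m k) * len k) = \<pi> (Vertex (hi k))"
    using edge_affineD[of len \<pi> k "m k" "len k"] by (simp add: edge_point_def)
  also have "\<dots> = circle_pt L (pos (hi k))" using assms(2) ends[OF k] by blast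
  finally show ?thesis using that by (auto simp: circle_pt_eq_iff)
qed

text \<open>No vertex lies over p_0, so the winding number counts the passages exactly. As a
  cardinality is nonnegative, the winding number cannot have the sign opposite to the slope.\<close>

lemma card_edge_crossings:
  assumes "cover_slope (len, \<omega>, \<pi>) m" and k: "k \<in> {1..r}"
    and "pos (lo k) + of_int (m k) * len k = pos (hi k) + of_int z * L"
  shows "int (card {x \<in> edge_set ends len k. \<pi> x = circle_pt L (P 0)}) = sgn (m k) * z"
proof -
  have *: "len k > 0" "m k \<noteq> 0" "edge_affine len \<pi> k (m k)"
    using assms(1) k by (auto simp: cover_slope_def)
  have "{x \<in> edge_set ends len k. \<pi> x = circle_pt L (P 0)} = edge_point ends len k `
      {t \<in> {0..len k}. circle_pt L (pos (lo k) + of_int (m k) * t) = circle_pt L (P 0)}"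
    using *(3) by (auto simp: edge_set_def edge_affine_def)
  also have "card \<dots> = card {t \<in> {0..len k}.
      circle_pt L (pos (lo k) + of_int (m k) * t) = circle_pt L (P 0)}"
    by (rule card_image[OF inj_on_subset[OF inj_edge_point[OF k]]]) auto
  finally show ?thesis
    using card_crossings[OF L_pos pos_bounds[OF ends(3)[OF k]] pos_bounds[OF ends(4)[OF k]] *(2,1) assms(3)]
    by simp
qed

section \<open>Balancing as conservation\<close>

text \<open>Without loops an edge has only one flag at \<open>i\<close>; the tag says whether
  \<open>i\<close> is its upper end.\<close>

lemma flag_in_star:
  assumes "i \<in> {1..n}"
  shows "bij_betw (\<lambda>k. (k, i = hi k)) (star i) (flags_at r ends i)"
proof (rule bij_betwI')
  fix k assume k: "k \<in> star i"
  show "(k, i = hi k) \<in> flags_at r ends i"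
    using ends(2)[of k i] k by (auto simp: flags_at_def)
next
  fix f assume f: "f \<in> flags_at r ends i"
  obtain k e where fk: "f = (k, e)" by (cases f)
  have k: "k \<in> {1..r}" and i: "i = (if e then hi k else lo k)"
    using f by (auto simp: flags_at_def fk)
  have "k \<in> star i" "e = (i = hi k)" using ends(1)[OF k] ends(2)[OF k, of i] k i by (auto split: if_splits)
  thus "\<exists>k\<in>star i. f = (k, i = hi k)" using fk by blast
qed auto

text \<open>\<open>maps_flag\<close> leaves base point and radius free; that it still determines the
  slope is \<open>circle_path_slope_unique\<close>. Conversely, the whole edge serves as the initial
  segment.\<close>

lemma maps_flag_iff:
  assumes c: "cover_slope c m" and k: "k \<in> star i" and s: "s \<in> {1, -1}"
  shows "maps_flag L ends c (k, i = hi k) (of_int s) \<longleftrightarrow> s = sgn (outflow m i k)"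
proof -
  obtain len \<omega> \<pi> where ceq: "c = (len, \<omega>, \<pi>)" by (cases c)
  have *: "len k > 0" "m k \<noteq> 0" "\<omega> k = nat \<bar>m k\<bar>" "edge_affine len \<pi> k (m k)"
    using c k by (auto simp: cover_slope_def ceq)
  define y where "y = outflow m i k"
  have y: "y = (if i = hi k then - m k else m k)"
    using ends(1)[of k] ends(2)[of k i] k by (auto simp: y_def outflow_def)
  have \<omega>: "real (\<omega> k) = of_int \<bar>y\<bar>" using * by (simp add: y)
  \<comment> \<open>At the upper end the edge is read backwards: the base moves by the total rise
    and the slope changes sign.\<close>
  define b where "b = pos (lo k) + (if i = hi k then of_int (m k) * len k else 0)"
  have fl: "\<pi> (flag_point ends len (k, i = hi k) t) = circle_pt L (b + of_int y * t)"
    if "t \<in> {0..len k}" for t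
    using that edge_affineD[OF *(4), of "len k - t"] edge_affineD[OF *(4), of t]
    by (auto simp: y b_def algebra_simps)
  show ?thesis unfolding y_def[symmetric]
  proof
    assume "maps_flag L ends c (k, i = hi k) (of_int s)"
    then obtain b' \<epsilon> where \<epsilon>: "\<epsilon> > 0" "\<epsilon> \<le> len k" "\<And>t. t \<in> {0..\<epsilon>} \<Longrightarrow>
        \<pi> (flag_point ends len (k, i = hi k) t) = circle_pt L (b' + of_int s * real (\<omega> k) * t)"
      by (auto simp: maps_flag_def ceq)
    have "of_int y = of_int s * real (\<omega> k)"
    proof (rule circle_path_slope_unique[OF L_pos \<epsilon>(1)])
      fix t assume t: "t \<in> {0..\<epsilon>}"
      hence "t \<in> {0..len k}" using \<epsilon>(2) by simp
      from fl[OF this] \<epsilon>(3)[OF t]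
      show "circle_pt L (b + of_int y * t) = circle_pt L (b' + of_int s * real (\<omega> k) * t)" by simp
    qed
    hence "real_of_int y = real_of_int (s * \<bar>y\<bar>)" by (simp add: \<omega>)
    hence "y = s * \<bar>y\<bar>" by (simp only: of_int_eq_iff)
    hence "sgn y = sgn s * sgn \<bar>y\<bar>" by (metis sgn_mult)
    moreover have "sgn \<bar>y\<bar> = 1" using * by (simp add: y)
    ultimately show "s = sgn y" using s by auto
  next
    assume "s = sgn y"
    hence s\<omega>: "real_of_int s * real (\<omega> k) = of_int y"
      unfolding \<omega> by (simp only: flip: of_int_mult) (simp add: sgn_mult_abs)
    thus "maps_flag L ends c (k, i = hi k) (of_int s)"
      unfolding maps_flag_def ceq prod.case fst_conv s\<omega> using fl *(1)
      by (intro exI[of _ b] exI[of _ "len k"]) (simp del: flag_point.simps)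
  qed
qed

text \<open>The two sums of the balancing condition are the positive and the negative part of the
  outflow.\<close>

lemma balanced_at_iff:
  assumes c: "cover_slope c m" and i: "i \<in> {1..n}"
  shows "balanced_at L r ends c i \<longleftrightarrow> (\<Sum>k\<in>star i. outflow m i k) = 0"
proof -
  obtain len \<omega> \<pi> where ceq: "c = (len, \<omega>, \<pi>)" by (cases c)
  have flux: "int (\<Sum>f | f \<in> flags_at r ends i \<and> maps_flag L ends c f (of_int s). \<omega> (fst f)) =
      (\<Sum>k\<in>star i. if s = sgn (outflow m i k) then \<bar>outflow m i k\<bar> else 0)"
    if s: "s \<in> {1, -1}" for s
  proof -
    have "finite (star i)" by simp
    hence fin: "finite (flags_at r ends i)" using flag_in_star[OF i] bij_betw_finite by blast
    have "(\<Sum>f | f \<in> flags_at r ends i \<and> maps_flag L ends c f (of_int s). \<omega> (fst f)) =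
        (\<Sum>f\<in>flags_at r ends i. if maps_flag L ends c f (of_int s) then \<omega> (fst f) else 0)"
      using fin by (simp add: sum.inter_filter)
    also have "\<dots> = (\<Sum>k\<in>star i. if maps_flag L ends c (k, i = hi k) (of_int s) then \<omega> k else 0)"
      by (subst sum.reindex_bij_betw[OF flag_in_star[OF i], symmetric]) (simp only: fst_conv)
    finally have eq: "(\<Sum>f | f \<in> flags_at r ends i \<and> maps_flag L ends c f (of_int s). \<omega> (fst f)) =
        (\<Sum>k\<in>star i. if maps_flag L ends c (k, i = hi k) (of_int s) then \<omega> k else 0)" .
    show ?thesis
      unfolding eq of_nat_sum
    proof (intro sum.cong refl)
      fix k assume k: "k \<in> star i"
      hence "int (\<omega> k) = \<bar>outflow m i k\<bar>"
        using c by (auto simp: cover_slope_def ceq outflow_def)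
      thus "int (if maps_flag L ends c (k, i = hi k) (of_int s) then \<omega> k else 0) =
          (if s = sgn (outflow m i k) then \<bar>outflow m i k\<bar> else 0)"
        using maps_flag_iff[OF c k s] by simp
    qed
  qed
  have "balanced_at L r ends c i \<longleftrightarrow>
      int (\<Sum>f | f \<in> flags_at r ends i \<and> maps_flag L ends c f (of_int 1). \<omega> (fst f)) =
      int (\<Sum>f | f \<in> flags_at r ends i \<and> maps_flag L ends c f (of_int (-1)). \<omega> (fst f))"
    unfolding balanced_at_def ceq prod.case of_nat_eq_iff of_int_1 of_int_minus by (rule refl)
  also have "\<dots> \<longleftrightarrow> (\<Sum>k\<in>star i. (if 1 = sgn (outflow m i k) then \<bar>outflow m i k\<bar> else 0) -
      (if -1 = sgn (outflow m i k) then \<bar>outflow m i k\<bar> else 0)) = 0"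
    unfolding flux[of 1, OF insertI1] flux[of "-1", OF insertI2[OF singletonI]] sum_subtractf
    by (rule eq_iff_diff_eq_0)
  finally have *: "balanced_at L r ends c i \<longleftrightarrow>
      (\<Sum>k\<in>star i. (if 1 = sgn (outflow m i k) then \<bar>outflow m i k\<bar> else 0) -
        (if -1 = sgn (outflow m i k) then \<bar>outflow m i k\<bar> else 0)) = 0" .
  have "(if 1 = sgn y then \<bar>y\<bar> else 0) - (if -1 = sgn y then \<bar>y\<bar> else 0) = y" for y :: int
    by (simp add: sgn_if)
  thus ?thesis unfolding * by simp
qed

section \<open>Surjectivity from conservation\<close>

text \<open>Renames the ends as source \<open>s\<close> and target \<open>t\<close> with respect to
  the circle, so that following an edge no longer depends on the sign of its slope.\<close>

lemma star_oriented:
  assumes k: "k \<in> {1..r}" "m k \<noteq> 0"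
  obtains s t where "s \<in> {1..n}" "t \<in> {1..n}" "\<forall>i. k \<in> star i \<longleftrightarrow> i = s \<or> i = t"
    "outflow m s k > 0" "outflow m t k < 0"
    "(m k > 0 \<and> s = lo k \<and> t = hi k) \<or> (m k < 0 \<and> s = hi k \<and> t = lo k)"
proof (cases "m k > 0")
  case True
  show ?thesis
    by (rule that[of "lo k" "hi k"]) (use True k ends[OF k(1)] in \<open>auto simp: outflow_def\<close>)
next
  case False
  show ?thesis
    by (rule that[of "hi k" "lo k"]) (use False k ends[OF k(1)] in \<open>auto simp: outflow_def\<close>)
qed

text \<open>Lifted so as to rise, the edge fills the interval from \<open>pos s\<close> to
  \<open>pos t + z * L\<close>; \<open>z\<close> is nonnegative because it counts passages over
  p_0.\<close>

lemma oriented_edge_image: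
  assumes c: "cover_slope (len, \<omega>, \<pi>) m"
    and V: "\<And>i. i \<in> {1..n} \<Longrightarrow> \<pi> (Vertex i) = circle_pt L (pos i)"
    and k: "k \<in> {1..r}"
  obtains s t :: nat and z :: int where "s \<in> {1..n}" "t \<in> {1..n}"
    "\<forall>i. k \<in> star i \<longleftrightarrow> i = s \<or> i = t" "outflow m s k > 0" "outflow m t k < 0"
    "z \<ge> 0" "pos s < pos t + of_int z * L"
    "\<forall>x. pos s \<le> x \<longrightarrow> x \<le> pos t + of_int z * L \<longrightarrow> circle_pt L x \<in> \<pi> ` metric_graph n r ends len"
proof -
  have *: "len k > 0" "m k \<noteq> 0" "edge_affine len \<pi> k (m k)"
    using c k by (auto simp: cover_slope_def)
  obtain z where z: "pos (lo k) + of_int (m k) * len k = pos (hi k) + of_int z * L"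
    using edge_closing[OF c V k] by blast
  have nonneg: "sgn (m k) * z \<ge> 0"
    using card_edge_crossings[OF c k z] by linarith
  have im: "circle_pt L (pos (lo k) + of_int (m k) * t) \<in> \<pi> ` metric_graph n r ends len"
    if "0 \<le> t" "t \<le> len k" for t
    using edge_affineD[OF *(3) that] that k
    by (auto simp: metric_graph_def edge_set_def intro!: rev_image_eqI[of "edge_point ends len k t"])
  obtain s t where st: "s \<in> {1..n}" "t \<in> {1..n}" "\<forall>i. k \<in> star i \<longleftrightarrow> i = s \<or> i = t"
    "outflow m s k > 0" "outflow m t k < 0"
    "(m k > 0 \<and> s = lo k \<and> t = hi k) \<or> (m k < 0 \<and> s = hi k \<and> t = lo k)"
    using star_oriented[of k m, OF k *(2)] by blast
  show ?thesis
  proof (cases "m k > 0")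
    case True
    hence st': "s = lo k" "t = hi k" using st by auto
    have mpos: "real_of_int (m k) > 0" using True by simp
    show ?thesis
    proof (rule that[OF st(1-5), of z])
      show "z \<ge> 0" using nonneg True by simp
      show "pos s < pos t + of_int z * L"
        unfolding st' z[symmetric] using mpos *(1) by simp
      show "\<forall>x. pos s \<le> x \<longrightarrow> x \<le> pos t + of_int z * L \<longrightarrow>
          circle_pt L x \<in> \<pi> ` metric_graph n r ends len"
      proof (intro allI impI)
        fix x assume x: "pos s \<le> x" "x \<le> pos t + of_int z * L"
        have "0 \<le> (x - pos (lo k)) / of_int (m k)" using x mpos st' by simp
        moreover have "(x - pos (lo k)) / of_int (m k) \<le> len k"
          unfolding pos_divide_le_eq[OF mpos] using x z st' by (simp add: mult.commute)
        ultimately have "circle_pt L (pos (lo k) + of_int (m k) * ((x - pos (lo k)) / of_int (m k)))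
            \<in> \<pi> ` metric_graph n r ends len" by (rule im)
        thus "circle_pt L x \<in> \<pi> ` metric_graph n r ends len" using mpos by simp
      qed
    qed
  next
    case False
    hence st': "s = hi k" "t = lo k" and "m k < 0" using st by auto
    hence mneg: "real_of_int (m k) < 0" by simp
    have z': "pos (lo k) + of_int (- z) * L = pos (hi k) - of_int (m k) * len k" using z by simp
    show ?thesis
    proof (rule that[OF st(1-5), of "- z"])
      show "- z \<ge> 0" using nonneg \<open>m k < 0\<close> by simp
      show "pos s < pos t + of_int (- z) * L"
        unfolding st' z' using mneg *(1) by (simp add: mult_neg_pos)
      show "\<forall>x. pos s \<le> x \<longrightarrow> x \<le> pos t + of_int (- z) * L \<longrightarrow>
          circle_pt L x \<in> \<pi> ` metric_graph n r ends len"
      proof (intro allI impI)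
        fix x assume x: "pos s \<le> x" "x \<le> pos t + of_int (- z) * L"
        \<comment> \<open>The parametrization starts at \<open>lo k\<close>, here the target, so the
          point is first moved by \<open>z\<close> periods into its range.\<close>
        let ?y = "x + of_int z * L"
        have y: "pos (lo k) + of_int (m k) * len k \<le> ?y" "?y \<le> pos (lo k)"
          using x z st' by auto
        have "0 \<le> (?y - pos (lo k)) / of_int (m k)"
          using y mneg by (intro divide_nonpos_neg) auto
        moreover have "(?y - pos (lo k)) / of_int (m k) \<le> len k"
          unfolding neg_divide_le_eq[OF mneg] using y by (simp add: mult.commute)
        ultimately have "circle_pt L (pos (lo k) + of_int (m k) * ((?y - pos (lo k)) / of_int (m k)))
            \<in> \<pi> ` metric_graph n r ends len" by (rule im)
        hence "circle_pt L ?y \<in> \<pi> ` metric_graph n r ends len" using mneg by simp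
        thus "circle_pt L x \<in> \<pi> ` metric_graph n r ends len" by (simp only: circle_pt_add_period)
      qed
    qed
  qed
qed

text \<open>A vanishing sum of nonzero terms over a nonempty set has terms of both signs.\<close>

lemma conserved_signs:
  assumes "conserved m" "i \<in> {1..n}" "\<And>k. k \<in> {1..r} \<Longrightarrow> m k \<noteq> 0"
  obtains k k' where "k \<in> star i" "outflow m i k > 0" "k' \<in> star i" "outflow m i k' < 0"
proof -
  have sum: "(\<Sum>k\<in>star i. outflow m i k) = 0" using assms(1,2) by (simp add: conserved_def)
  have nz: "outflow m i k \<noteq> 0" if "k \<in> star i" for k
    using assms(3) that by (auto simp: outflow_def)
  have ne: "star i \<noteq> {}" using no_isolated[OF assms(2)] by auto
  have "\<exists>k\<in>star i. outflow m i k > 0"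
  proof (rule ccontr)
    assume "\<not> ?thesis"
    hence "outflow m i k < 0" if "k \<in> star i" for k using nz[OF that] that by force
    hence "(\<Sum>k\<in>star i. outflow m i k) < (\<Sum>k\<in>star i. 0)"
      using ne by (intro sum_strict_mono) auto
    thus False using sum by simp
  qed
  moreover have "\<exists>k\<in>star i. outflow m i k < 0"
  proof (rule ccontr)
    assume "\<not> ?thesis"
    hence "outflow m i k > 0" if "k \<in> star i" for k using nz[OF that] that by force
    hence "(\<Sum>k\<in>star i. 0) < (\<Sum>k\<in>star i. outflow m i k)"
      using ne by (intro sum_strict_mono) auto
    thus False using sum by simp
  qed
  ultimately show ?thesis using that by blast
qed

text \<open>
  By conservation every vertex has an edge leaving it in either direction; following these edges
  until \<open>P 0\<close> is reached covers both arcs between the vertex and \<open>P 0\<close>.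
\<close>

lemma cover_surj:
  assumes c: "cover_slope (len, \<omega>, \<pi>) m"
    and V: "\<And>i. i \<in> {1..n} \<Longrightarrow> \<pi> (Vertex i) = circle_pt L (pos i)"
    and bal: "conserved m"
  shows "\<pi> ` metric_graph n r ends len = circle L"
proof
  let ?I = "\<pi> ` metric_graph n r ends len"
  have nz: "m k \<noteq> 0" if "k \<in> {1..r}" for k using c that by (auto simp: cover_slope_def)
  have "\<pi> (edge_point ends len k t) \<in> circle L" if "k \<in> {1..r}" "t \<in> {0..len k}" for k t
    using c that by (auto simp: cover_slope_def edge_affine_def circle_def)
  thus "?I \<subseteq> circle L"
    using V by (auto simp: metric_graph_def edge_set_def circle_def)
  have fwd: "circle_pt L x \<in> ?I" if "i \<in> {1..n}" "pos i \<le> x" "x \<le> P 0 + L" for i x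
    using that
  proof (induction "n - \<Omega> i" arbitrary: i rule: less_induct)
    case less
    obtain k where k: "k \<in> star i" "outflow m i k > 0"
      using conserved_signs[OF bal less.prems(1) nz] by metis
    hence kr: "k \<in> {1..r}" by simp
    obtain s t z where e: "s \<in> {1..n}" "t \<in> {1..n}" "\<forall>i. k \<in> star i \<longleftrightarrow> i = s \<or> i = t"
      "outflow m s k > 0" "outflow m t k < 0" "z \<ge> (0::int)" "pos s < pos t + of_int z * L"
      "\<forall>x. pos s \<le> x \<longrightarrow> x \<le> pos t + of_int z * L \<longrightarrow> circle_pt L x \<in> ?I"
      by (rule oriented_edge_image[OF c V kr])
    have "i = s" using spec[OF e(3), of i] e(5) k by auto
    show ?case
    proof (cases "x \<le> pos t + of_int z * L")
      case True
      thus ?thesis using e(8) less.prems \<open>i = s\<close> by blast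
    next
      case False
      \<comment> \<open>An edge that winds at all ends above \<open>P 0 + L\<close>, hence not below
        \<open>x\<close>.\<close>
      have "z = 0"
      proof (rule ccontr)
        assume "z \<noteq> 0"
        hence "1 * L \<le> of_int z * L" using e(6) L_pos by (intro mult_right_mono) auto
        thus False using False less.prems(3) pos_bounds[OF e(2)] by linarith
      qed
      hence "pos i < pos t" "pos t \<le> x" using e(7) \<open>i = s\<close> False by auto
      moreover have "n - \<Omega> t < n - \<Omega> i"
        using \<open>pos i < pos t\<close> pos_less_iff[OF less.prems(1) e(2)] Omega_mem[OF e(2)] by auto
      ultimately show ?thesis using less.hyps[of t] e(2) less.prems(3) by blast
    qed
  qed
  have bwd: "circle_pt L x \<in> ?I" if "i \<in> {1..n}" "x \<le> pos i" "P 0 \<le> x" for i x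
    using that
  proof (induction "\<Omega> i" arbitrary: i rule: less_induct)
    case less
    obtain k where k: "k \<in> star i" "outflow m i k < 0"
      using conserved_signs[OF bal less.prems(1) nz] by metis
    hence kr: "k \<in> {1..r}" by simp
    obtain s t z where e: "s \<in> {1..n}" "t \<in> {1..n}" "\<forall>i. k \<in> star i \<longleftrightarrow> i = s \<or> i = t"
      "outflow m s k > 0" "outflow m t k < 0" "z \<ge> (0::int)" "pos s < pos t + of_int z * L"
      "\<forall>x. pos s \<le> x \<longrightarrow> x \<le> pos t + of_int z * L \<longrightarrow> circle_pt L x \<in> ?I"
      by (rule oriented_edge_image[OF c V kr])
    have "i = t" using spec[OF e(3), of i] e(4) k by auto
    show ?case
    proof (cases "pos s \<le> x + of_int z * L")
      case True
      hence "circle_pt L (x + of_int z * L) \<in> ?I" using e(8) less.prems(2) \<open>i = t\<close> by auto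
      thus ?thesis by (simp only: circle_pt_add_period)
    next
      case False
      have "z = 0"
      proof (rule ccontr)
        assume "z \<noteq> 0"
        hence "1 * L \<le> of_int z * L" using e(6) L_pos by (intro mult_right_mono) auto
        thus False using False less.prems(3) pos_bounds[OF e(1)] by linarith
      qed
      hence "pos s < pos i" "x \<le> pos s" using e(7) \<open>i = t\<close> False by auto
      moreover have "\<Omega> s < \<Omega> i"
        using \<open>pos s < pos i\<close> pos_less_iff[OF e(1) less.prems(1)] by simp
      ultimately show ?thesis using less.hyps[of s] e(1) less.prems(3) by blast
    qed
  qed
  show "circle L \<subseteq> ?I"
  proof
    fix C assume "C \<in> circle L"
    then obtain x where x: "C = circle_pt L x" by (auto simp: circle_def)
    define z where "z = \<lfloor>(x - P 0) / L\<rfloor>"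
    define y where "y = x - of_int z * L"
    have "of_int z \<le> (x - P 0) / L" "(x - P 0) / L < of_int z + 1"
      by (auto simp: z_def)
    hence "of_int z * L \<le> x - P 0" "x - P 0 < (of_int z + 1) * L"
      using L_pos by (simp_all add: pos_le_divide_eq pos_divide_less_eq)
    hence y: "P 0 \<le> y" "y \<le> P 0 + L" by (auto simp: y_def algebra_simps)
    have "1 \<in> {1..n}" using graph by (simp add: feynman_graph_def)
    hence "circle_pt L y \<in> ?I" using fwd[of 1 y] bwd[of 1 y] y by linarith
    moreover have "C = circle_pt L y"
      using circle_pt_add_period[of L y z] by (simp add: x y_def)
    ultimately show "C \<in> ?I" by simp
  qed
qed

text \<open>Once slopes are given, positivity and affinity are built in, and surjectivity follows
  from conservation by \<open>cover_surj\<close>.\<close>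

lemma is_cover_iff:
  assumes c: "cover_slope (len, \<omega>, \<pi>) m"
  shows "is_cover L P n r ends a \<Omega> (len, \<omega>, \<pi>) \<longleftrightarrow>
     (\<forall>i\<in>{1..n}. \<pi> (Vertex i) = circle_pt L (pos i)) \<and> conserved m \<and>
     (\<forall>k\<in>{1..r}. int (card {x \<in> edge_set ends len k. \<pi> x = circle_pt L (P 0)}) * \<bar>m k\<bar> = int (a k))"
    (is "_ \<longleftrightarrow> ?V \<and> _ \<and> ?deg")
proof -
  have slope: "len k > 0" "\<omega> k > 0" "int (\<omega> k) = \<bar>m k\<bar>" "edge_affine len \<pi> k (m k)"
    if "k \<in> {1..r}" for k
    using c that by (auto simp: cover_slope_def)
  have affine: "\<exists>b. \<exists>s\<in>{1, -1}. \<forall>t\<in>{0..len k}.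
      \<pi> (edge_point ends len k t) = circle_pt L (b + s * real (\<omega> k) * t)" if k: "k \<in> {1..r}" for k
  proof -
    have "real (\<omega> k) = of_int \<bar>m k\<bar>" using slope(3)[OF k] by (metis of_int_of_nat_eq)
    hence "of_int (sgn (m k)) * real (\<omega> k) = of_int (m k)"
      by (simp only: flip: of_int_mult) (simp add: sgn_mult_abs)
    moreover have "of_int (sgn (m k)) \<in> {1, -1 :: real}"
      using slope(2,3)[OF k] by (auto simp: sgn_if)
    ultimately show ?thesis using slope(4)[OF k] unfolding edge_affine_def by metis
  qed
  have bal: "(\<forall>i\<in>{1..n}. balanced_at L r ends (len, \<omega>, \<pi>) i) \<longleftrightarrow> conserved m"
    using balanced_at_iff[OF c] by (simp add: conserved_def)
  have "card {x \<in> edge_set ends len k. \<pi> x = circle_pt L (P 0)} * \<omega> k = a k \<longleftrightarrow>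
      int (card {x \<in> edge_set ends len k. \<pi> x = circle_pt L (P 0)}) * \<bar>m k\<bar> = int (a k)"
    if "k \<in> {1..r}" for k
    unfolding slope(3)[OF that, symmetric] by (simp flip: of_nat_mult)
  hence deg: "(\<forall>k\<in>{1..r}. card {x \<in> edge_set ends len k. \<pi> x = circle_pt L (P 0)} * \<omega> k = a k) \<longleftrightarrow> ?deg"
    by simp
  have len: "(\<forall>k\<in>{1..r}. len k > 0) \<longleftrightarrow> True"
    using slope(1) by blast
  have aff: "(\<forall>k\<in>{1..r}. \<omega> k > 0 \<and> (\<exists>b. \<exists>s\<in>{1, -1}. \<forall>t\<in>{0..len k}.
      \<pi> (edge_point ends len k t) = circle_pt L (b + s * real (\<omega> k) * t))) \<longleftrightarrow> True"
    using slope(2) affine by blast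
  have surj: "?V \<Longrightarrow> conserved m \<Longrightarrow> \<pi> ` metric_graph n r ends len = circle L"
    using cover_surj[OF c] by blast
  show ?thesis
    unfolding is_cover_def prod.case bal deg len aff using surj by argo
qed

section \<open>Flows and the covers built from them\<close>

text \<open>An edge with \<open>a k > 0\<close> may run around the circle in either direction, so
  only the size of its value is constrained.\<close>

definition flows :: "(nat \<Rightarrow> int) set" where
  "flows = {m \<in> extensional {1..r}. conserved m \<and> (\<forall>k\<in>{1..r}. m k \<noteq> 0 \<and>
     (if a k = 0 then 0 < m k \<longleftrightarrow> \<Omega> (lo k) < \<Omega> (hi k) else nat \<bar>m k\<bar> dvd a k))}"

text \<open>The closing equation of the edge solved for its length; the coefficient of
  \<open>L\<close> is the winding number dictated by the degree.\<close>

definition flow_length :: "(nat \<Rightarrow> int) \<Rightarrow> nat \<Rightarrow> real" where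
  "flow_length m k =
     (pos (hi k) - pos (lo k) + of_int (sgn (m k) * int (a k div nat \<bar>m k\<bar>)) * L) / of_int (m k)"

fun flow_map :: "(nat \<Rightarrow> int) \<Rightarrow> gpoint \<Rightarrow> real set" where
  "flow_map m (Vertex i) = circle_pt L (pos i)"
| "flow_map m (Inner k t) = circle_pt L (pos (lo k) + of_int (m k) * t)"

definition flow_cover :: "(nat \<Rightarrow> int) \<Rightarrow> cover" where
  "flow_cover m = (flow_length m, \<lambda>k. nat \<bar>m k\<bar>, flow_map m)"

text \<open>The degree of an edge determines its winding number, and hence its length.\<close>

lemma cover_edge_data:
  assumes cov: "is_cover L P n r ends a \<Omega> (len, \<omega>, \<pi>)" and c: "cover_slope (len, \<omega>, \<pi>) m"
    and k: "k \<in> {1..r}"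
  shows "len k = flow_length m k" "nat \<bar>m k\<bar> dvd a k"
proof -
  have m: "m k \<noteq> 0" using c k by (auto simp: cover_slope_def)
  obtain z where z: "pos (lo k) + of_int (m k) * len k = pos (hi k) + of_int z * L"
    using edge_closing[OF c _ k] cov c is_cover_iff by blast
  define C where "C = card {x \<in> edge_set ends len k. \<pi> x = circle_pt L (P 0)}"
  have "int C * \<bar>m k\<bar> = int (a k)"
    using cov k unfolding is_cover_iff[OF c] C_def by blast
  hence ak: "a k = C * nat \<bar>m k\<bar>"
    by (metis abs_ge_zero int_nat_eq nat_int nat_mult_distrib of_nat_0_le_iff)
  thus "nat \<bar>m k\<bar> dvd a k" by simp
  have "a k div nat \<bar>m k\<bar> = C" using m by (simp add: ak)
  moreover have "int C = sgn (m k) * z"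
    unfolding C_def by (rule card_edge_crossings[OF c k z])
  ultimately have "sgn (m k) * int (a k div nat \<bar>m k\<bar>) = sgn (m k) * sgn (m k) * z" by simp
  also have "\<dots> = z" using m by (simp add: sgn_if)
  finally show "len k = flow_length m k"
    using z m by (simp add: flow_length_def field_simps)
qed

lemma cover_slope_in_flows:
  assumes cov: "is_cover L P n r ends a \<Omega> c" and c: "cover_slope c m" and "m \<in> extensional {1..r}"
  shows "m \<in> flows"
proof -
  obtain len \<omega> \<pi> where ceq: "c = (len, \<omega>, \<pi>)" by (cases c)
  have "conserved m" using cov is_cover_iff[of len \<omega> \<pi> m] c by (simp add: ceq)
  moreover have "0 < m k \<longleftrightarrow> \<Omega> (lo k) < \<Omega> (hi k)" if k: "k \<in> {1..r}" and "a k = 0" for k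
  proof -
    have l: "len k > 0" "m k \<noteq> 0" using c k by (auto simp: ceq cover_slope_def)
    \<comment> \<open>The winding number is 0, and positivity of this quotient forces slope and
      difference of positions to have equal signs.\<close>
    have "len k = (pos (hi k) - pos (lo k)) / of_int (m k)"
      using cover_edge_data(1)[of len \<omega> \<pi> m k] cov c k that by (simp add: ceq flow_length_def)
    hence "0 < m k \<longleftrightarrow> pos (lo k) < pos (hi k)"
      using l by (auto simp: zero_less_divide_iff)
    thus ?thesis using pos_less_iff ends[OF k] by simp
  qed
  moreover have "m k \<noteq> 0 \<and> nat \<bar>m k\<bar> dvd a k" if k: "k \<in> {1..r}" for k
    using c k cover_edge_data(2)[of len \<omega> \<pi> m k] cov by (auto simp: ceq cover_slope_def)
  ultimately show ?thesis
    using assms(3) by (simp add: flows_def)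
qed

lemma flowsD:
  assumes "m \<in> flows" "k \<in> {1..r}"
  shows "m k \<noteq> 0" "a k = 0 \<Longrightarrow> 0 < m k \<longleftrightarrow> \<Omega> (lo k) < \<Omega> (hi k)"
    "a k \<noteq> 0 \<Longrightarrow> nat \<bar>m k\<bar> dvd a k"
proof -
  have "m k \<noteq> 0 \<and> (if a k = 0 then 0 < m k \<longleftrightarrow> \<Omega> (lo k) < \<Omega> (hi k) else nat \<bar>m k\<bar> dvd a k)"
    using assms unfolding flows_def by blast
  thus "m k \<noteq> 0" "a k = 0 \<Longrightarrow> 0 < m k \<longleftrightarrow> \<Omega> (lo k) < \<Omega> (hi k)"
    "a k \<noteq> 0 \<Longrightarrow> nat \<bar>m k\<bar> dvd a k" by argo+
qed

text \<open>For positivity the total rise must have the sign of the slope. If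
  \<open>a k = 0\<close>, this is the sign condition of a flow; otherwise at least one full period
  is added, which outweighs any difference of two positions.\<close>

lemma flow_length:
  assumes m: "m \<in> flows" and k: "k \<in> {1..r}"
  shows "flow_length m k > 0"
    "pos (lo k) + of_int (m k) * flow_length m k =
      pos (hi k) + of_int (sgn (m k) * int (a k div nat \<bar>m k\<bar>)) * L"
proof -
  let ?c = "a k div nat \<bar>m k\<bar>"
  note nz = flowsD(1)[OF m k] and 0 = flowsD(2)[OF m k] and dvd = flowsD(3)[OF m k]
  show "pos (lo k) + of_int (m k) * flow_length m k =
      pos (hi k) + of_int (sgn (m k) * int ?c) * L"
    using nz by (simp add: flow_length_def)
  have lh: "lo k \<in> {1..n}" "hi k \<in> {1..n}" using ends(3,4)[OF k] .
  have "\<Omega> (lo k) \<noteq> \<Omega> (hi k)"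
    using ends(1)[OF k] by (simp add: inj_eq[OF permutes_inj[OF order]])
  hence ne: "pos (lo k) < pos (hi k) \<or> pos (hi k) < pos (lo k)"
    unfolding pos_less_iff[OF lh] pos_less_iff[OF lh(2,1)] by linarith
  have num: "sgn (m k) = sgn (pos (hi k) - pos (lo k) + of_int (sgn (m k) * int ?c) * L)"
  proof (cases "a k = 0")
    case True
    hence "0 < m k \<longleftrightarrow> pos (lo k) < pos (hi k)" using 0 pos_less_iff[OF lh] by blast
    thus ?thesis using ne nz True by (cases "0 < m k") simp_all
  next
    case False
    hence "?c \<noteq> 0" using dvd by (metis dvd_div_eq_0_iff)
    hence "?c \<ge> 1" by simp
    define X where "X = real ?c * L"
    have "1 * L \<le> X"
      unfolding X_def using \<open>?c \<ge> 1\<close> L_pos by (intro mult_right_mono) auto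
    moreover have "of_int (sgn (m k) * int ?c) * L = of_int (sgn (m k)) * X" by (simp add: X_def)
    ultimately show ?thesis
      using nz pos_bounds[OF lh(1)] pos_bounds[OF lh(2)] by (cases "0 < m k") simp_all
  qed
  show "flow_length m k > 0"
    unfolding flow_length_def zero_less_divide_iff of_int_0_less_iff of_int_less_0_iff
    using nz num by (cases "0 < m k") (simp_all add: sgn_if split: if_splits)
qed

lemma flow_cover:
  assumes m: "m \<in> flows"
  shows "is_cover L P n r ends a \<Omega> (flow_cover m)" "cover_slope (flow_cover m) m"
proof -
  note nz = flowsD(1,3)[OF m]
  have "edge_affine (flow_length m) (flow_map m) k (m k)" if k: "k \<in> {1..r}" for k
  proof -
    \<comment> \<open>At the far end \<open>edge_point\<close> yields a vertex, whose image must
      agree with the affine formula; the length was chosen for this.\<close>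
    have "circle_pt L (pos (lo k) + of_int (m k) * flow_length m k) = circle_pt L (pos (hi k))"
      unfolding flow_length(2)[OF m k] by (rule circle_pt_add_period)
    thus ?thesis by (auto simp: edge_affine_def edge_point_def)
  qed
  thus c: "cover_slope (flow_cover m) m"
    using flow_length(1)[OF m] nz by (simp add: cover_slope_def flow_cover_def)
  have "int (card {x \<in> edge_set ends (flow_length m) k. flow_map m x = circle_pt L (P 0)}) * \<bar>m k\<bar> = int (a k)"
    if k: "k \<in> {1..r}" for k
  proof -
    have card: "int (card {x \<in> edge_set ends (flow_length m) k. flow_map m x = circle_pt L (P 0)}) =
        sgn (m k) * (sgn (m k) * int (a k div nat \<bar>m k\<bar>))"
      using c k flow_length(2)[OF m k] unfolding flow_cover_def by (rule card_edge_crossings)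
    have "int (a k div nat \<bar>m k\<bar>) * int (nat \<bar>m k\<bar>) = int (a k)"
      unfolding of_nat_mult[symmetric] of_nat_eq_iff using nz(2)[OF k]
      by (cases "a k = 0") (simp, rule dvd_div_mult_self)
    thus ?thesis
      unfolding card using nz(1)[OF k] by (cases "0 < m k") simp_all
  qed
  thus "is_cover L P n r ends a \<Omega> (flow_cover m)"
    using c m by (simp add: flow_cover_def is_cover_iff flows_def)
qed

section \<open>Isomorphism classes of covers\<close>

lemma metric_graph_cong:
  assumes "\<And>k. k \<in> {1..r} \<Longrightarrow> len k = len' k"
  shows "metric_graph n r ends len = metric_graph n r ends len'"
proof -
  have "edge_set ends len k = edge_set ends len' k" if "k \<in> {1..r}" for k
    using assms[OF that] by (auto simp: edge_set_def edge_point_def)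
  thus ?thesis unfolding metric_graph_def by simp
qed

text \<open>An isomorphism fixes both ends, which differ, so it cannot reverse an edge; an isometry
  of intervals starting at 0 that fixes 0 is the identity.\<close>

lemma labeled_isometry_edge:
  assumes "labeled_isometry n r ends len len' \<phi>" "k \<in> {1..r}" "len k > 0" "t \<in> {0..len k}"
  shows "t \<in> {0..len' k}" "\<phi> (edge_point ends len k t) = edge_point ends len' k t"
proof -
  obtain g where g: "bij_betw g {0..len k} {0..len' k}"
    "\<And>s t. s \<in> {0..len k} \<Longrightarrow> t \<in> {0..len k} \<Longrightarrow> \<bar>g s - g t\<bar> = \<bar>s - t\<bar>"
    "\<And>t. t \<in> {0..len k} \<Longrightarrow> \<phi> (edge_point ends len k t) = edge_point ends len' k (g t)"
    using assms(1,2) unfolding labeled_isometry_def by blast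
  have gin: "g t \<in> {0..len' k}" if "t \<in> {0..len k}" for t
    using g(1) that by (rule bij_betwE[THEN bspec])
  have "\<phi> (Vertex (lo k)) = Vertex (lo k)"
    using assms(1) ends(3)[OF assms(2)] unfolding labeled_isometry_def by blast
  hence "g 0 = 0"
    using g(3)[of 0] assms(3) ends(1)[OF assms(2)] by (auto simp: edge_point_def split: if_splits)
  hence "g t = t"
    using g(2)[OF assms(4), of 0] gin[OF assms(4)] assms(3,4) by simp
  thus "t \<in> {0..len' k}" "\<phi> (edge_point ends len k t) = edge_point ends len' k t"
    using gin[OF assms(4)] g(3)[OF assms(4)] by simp_all
qed

text \<open>Isomorphic covers agree at equal parameters of each edge, hence in their slopes.
  Conversely, equal slopes and the common degree give equal lengths, and then the identity is an
  isomorphism.\<close>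

lemma cover_iso_iff:
  assumes cov: "is_cover L P n r ends a \<Omega> c" "is_cover L P n r ends a \<Omega> c'"
    and sl: "cover_slope c m" "cover_slope c' m'" and ext: "m \<in> extensional {1..r}" "m' \<in> extensional {1..r}"
  shows "(c, c') \<in> cover_iso L P n r ends a \<Omega> \<longleftrightarrow> m = m'"
proof -
  obtain len \<omega> \<pi> where c: "c = (len, \<omega>, \<pi>)" by (cases c)
  obtain len' \<omega>' \<pi>' where c': "c' = (len', \<omega>', \<pi>')" by (cases c')
  note sl = sl[unfolded c c'] and cov = cov[unfolded c c']
  have slope: "len k > 0" "edge_affine len \<pi> k (m k)" "edge_affine len' \<pi>' k (m' k)" if "k \<in> {1..r}" for k
    using sl that by (auto simp: cover_slope_def)
  show ?thesis
  proof
    assume "(c, c') \<in> cover_iso L P n r ends a \<Omega>"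
    then obtain \<phi> where iso: "labeled_isometry n r ends len len' \<phi>"
      and eq: "\<And>x. x \<in> metric_graph n r ends len \<Longrightarrow> \<pi>' (\<phi> x) = \<pi> x"
      by (auto simp: cover_iso_def c c')
    have "m k = m' k" if k: "k \<in> {1..r}" for k
    proof (rule edge_affine_unique[OF slope(2)[OF k] _ slope(1)[OF k]])
      show "edge_affine len \<pi> k (m' k)"
        unfolding edge_affine_def
      proof
        fix t assume t: "t \<in> {0..len k}"
        have "edge_point ends len k t \<in> metric_graph n r ends len"
          unfolding metric_graph_def edge_set_def using k t by blast
        from eq[OF this] have "\<pi> (edge_point ends len k t) = \<pi>' (edge_point ends len' k t)"
          using labeled_isometry_edge(2)[OF iso k slope(1)[OF k] t] by simp
        also have "\<dots> = circle_pt L (pos (lo k) + of_int (m' k) * t)"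
          using slope(3)[OF k] labeled_isometry_edge(1)[OF iso k slope(1)[OF k] t]
          by (simp add: edge_affine_def)
        finally show "\<pi> (edge_point ends len k t) = circle_pt L (pos (lo k) + of_int (m' k) * t)" .
      qed
    qed
    thus "m = m'" using ext by (intro extensionalityI) auto
  next
    assume "m = m'"
    hence len: "len k = len' k" if "k \<in> {1..r}" for k
      using cover_edge_data(1)[OF cov(1) sl(1) that] cover_edge_data(1)[OF cov(2) sl(2) that] by simp
    have edge: "edge_point ends len k t = edge_point ends len' k t" if "k \<in> {1..r}" for k t
      using len[OF that] by (simp add: edge_point_def)
    have "labeled_isometry n r ends len len' id"
      unfolding labeled_isometry_def using metric_graph_cong[of len len'] len edge
      by (auto intro!: exI[of _ id])
    moreover have "\<pi>' (id x) = \<pi> x" if "x \<in> metric_graph n r ends len" for x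
    proof -
      consider i where "i \<in> {1..n}" "x = Vertex i"
        | k t where "k \<in> {1..r}" "t \<in> {0..len k}" "x = edge_point ends len k t"
        using \<open>x \<in> metric_graph n r ends len\<close> unfolding metric_graph_def edge_set_def by blast
      thus ?thesis
      proof cases
        case 1
        thus ?thesis using cov is_cover_iff[OF sl(1)] is_cover_iff[OF sl(2)] by simp
      next
        case 2
        thus ?thesis
          using slope(2,3)[OF 2(1)] len[OF 2(1)] edge[OF 2(1)] \<open>m = m'\<close>
          by (simp add: edge_affine_def)
      qed
    qed
    ultimately show "(c, c') \<in> cover_iso L P n r ends a \<Omega>"
      using cov unfolding cover_iso_def c c' by blast
  qed
qed

lemma cover_count_eq_sum_flows:
  "cover_count L P n r ends a \<Omega> = (\<Sum>m\<in>flows. \<Prod>k=1..r. nat \<bar>m k\<bar>)"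
proof -
  let ?S = "{c. is_cover L P n r ends a \<Omega> c}"
  \<comment> \<open>The choice is unambiguous, since an extensional slope is unique.\<close>
  define h where "h c = (SOME m. m \<in> extensional {1..r} \<and> cover_slope c m)" for c
  have h: "h c \<in> extensional {1..r} \<and> cover_slope c (h c)" if "c \<in> ?S" for c
  proof -
    have "is_cover L P n r ends a \<Omega> c" using that by blast
    then obtain m where "m \<in> extensional {1..r} \<and> cover_slope c m"
      by (elim cover_slope_exists) blast
    thus ?thesis unfolding h_def
      by (rule someI[where P = "\<lambda>m. m \<in> extensional {1..r} \<and> cover_slope c m"])
  qed
  have "h ` ?S = flows"
  proof (intro equalityI subsetI)
    fix m assume "m \<in> h ` ?S"
    thus "m \<in> flows" using h cover_slope_in_flows by blast
  next
    fix m assume m: "m \<in> flows"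
    have S: "flow_cover m \<in> ?S" using flow_cover(1)[OF m] by simp
    have "h (flow_cover m) = m"
      using h[OF S] flow_cover(2)[OF m] m
      by (intro extensionalityI[of _ "{1..r}"] cover_slope_unique) (auto simp: flows_def)
    thus "m \<in> h ` ?S" by (intro image_eqI[OF _ S]) (rule sym)
  qed
  moreover have "cover_mult r c = (\<Prod>k=1..r. nat \<bar>h c k\<bar>)" if "c \<in> ?S" for c
    using h[OF that] by (cases c) (auto simp: cover_mult_def cover_slope_def intro!: prod.cong)
  moreover have "(c, c') \<in> cover_iso L P n r ends a \<Omega> \<longleftrightarrow> h c = h c'" if "c \<in> ?S" "c' \<in> ?S" for c c'
    using that h[OF that(1)] h[OF that(2)] by (intro cover_iso_iff) auto
  ultimately show ?thesis
    unfolding cover_count_def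
    using sum_quotient_fibres[OF equiv_cover_iso, of L P n r ends a \<Omega> h "cover_mult r"
      "\<lambda>m. \<Prod>k=1..r. nat \<bar>m k\<bar>"] by auto
qed

end


section \<open>Matrix elements of products of operators\<close>

lemma op_prod_simps [simp]:
  "op_prod [] v = v" "op_prod (A # As) v = A (op_prod As v)"
  "op_prod (As @ Bs) v = op_prod As (op_prod Bs v)"
  by (induction As) (simp_all add: op_prod_def)

lemma op_prod_concat: "op_prod (concat (map g xs)) v = op_prod (map (\<lambda>x. op_prod (g x)) xs) v"
  by (induction xs arbitrary: v) simp_all

lemma additive_sum:
  fixes A :: "'a::comm_monoid_add \<Rightarrow> 'b::comm_monoid_add"
  assumes "A 0 = 0" "\<And>v w. A (v + w) = A v + A w"
  shows "A (sum g S) = (\<Sum>x\<in>S. A (g x))"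
  by (induction S rule: infinite_finite_induct) (simp_all add: assms)

text \<open>The vector that a factor meets is formed with the operators \<open>M\<close>, hence is
  fixed before the truncation; finitely many factors then admit a common threshold.\<close>

lemma op_prod_eventually:
  assumes "\<And>i v. i \<in> set is \<Longrightarrow> \<forall>\<^sub>F B in F. M i v = M' B i v"
  shows "\<forall>\<^sub>F B in F. op_prod (map M is) v = op_prod (map (M' B) is) v"
  using assms
proof (induction "is")
  case (Cons i js)
  have "\<forall>\<^sub>F B in F. op_prod (map M js) v = op_prod (map (M' B) js) v"
    using Cons by simp
  moreover have "\<forall>\<^sub>F B in F. M i (op_prod (map M js) v) = M' B i (op_prod (map M js) v)"
    using Cons.prems by simp
  ultimately show ?case
    by eventually_elim simp
qed simp

text \<open>Distributivity; as the list is distinct, one function on its set records an independent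
  choice for each factor.\<close>

lemma op_prod_sum:
  assumes "distinct is"
    and "\<And>i t. A i t 0 = 0" "\<And>i t v w. A i t (v + w) = A i t v + A i t w"
  shows "op_prod (map (\<lambda>i v. \<Sum>t\<in>T. A i t v) is) v =
    (\<Sum>f\<in>set is \<rightarrow>\<^sub>E T. op_prod (map (\<lambda>i. A i (f i)) is) v)"
  using assms(1)
proof (induction "is")
  case (Cons i js)
  have i: "i \<notin> set js" and IH: "op_prod (map (\<lambda>i v. \<Sum>t\<in>T. A i t v) js) v =
    (\<Sum>f\<in>set js \<rightarrow>\<^sub>E T. op_prod (map (\<lambda>i. A i (f i)) js) v)" using Cons by auto
  have "(\<Sum>f\<in>set (i # js) \<rightarrow>\<^sub>E T. op_prod (map (\<lambda>i. A i (f i)) (i # js)) v) =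
      (\<Sum>(t, f)\<in>T \<times> (set js \<rightarrow>\<^sub>E T). A i t (op_prod (map (\<lambda>i. A i (f i)) js) v))"
    unfolding list.set PiE_insert_eq
  proof (subst sum.reindex, rule inj_combinator, rule i, rule sum.cong)
    fix p assume "p \<in> T \<times> (set js \<rightarrow>\<^sub>E T)"
    obtain t f where p: "p = (t, f)" by (cases p)
    have maps: "map (\<lambda>k. A k ((f(i := t)) k)) js = map (\<lambda>k. A k (f k)) js"
      using i by (intro map_cong) auto
    have "op_prod (map (\<lambda>k. A k ((f(i := t)) k)) js) v = op_prod (map (\<lambda>k. A k (f k)) js) v"
      unfolding maps ..
    thus "((\<lambda>f. op_prod (map (\<lambda>i. A i (f i)) (i # js)) v) \<circ> (\<lambda>(y, g). g(i := y))) p =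
      (case p of (t, f) \<Rightarrow> A i t (op_prod (map (\<lambda>i. A i (f i)) js) v))"
      by (simp add: p)
  qed simp
  also have "\<dots> = (\<Sum>t\<in>T. \<Sum>f\<in>set js \<rightarrow>\<^sub>E T. A i t (op_prod (map (\<lambda>i. A i (f i)) js) v))"
    by (rule sum.cartesian_product[symmetric])
  also have "\<dots> = (\<Sum>t\<in>T. A i t (op_prod (map (\<lambda>i v. \<Sum>t\<in>T. A i t v) js) v))"
    unfolding IH by (intro sum.cong refl additive_sum[symmetric] assms)
  finally show ?case by simp
qed simp

lemma fock_inner_zero_right [simp]: "fock_inner v 0 = 0"
  by (simp add: fock_inner_def)

lemma fock_inner_sum_right: "fock_inner v (sum g S) = (\<Sum>x\<in>S. fock_inner v (g x))"
  by (rule additive_sum) (simp_all add: fock_inner_add_right)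

section \<open>Amplitudes of words against monomials\<close>

definition mono_vec :: "mode multiset \<Rightarrow> fock" where
  "mono_vec \<mu> = Poly_Mapping.single \<mu> 1"

definition alpha_op :: "nat \<times> nat \<times> int \<Rightarrow> fock \<Rightarrow> fock" where
  "alpha_op x = (case x of (k, j, m) \<Rightarrow> alpha k j m)"

lemma alpha_op_Pair: "alpha_op (k, j, m) = alpha k j m"
  by (simp add: alpha_op_def)

text \<open>Words are evaluated from the left: by adjointness the first letter moves to the
  monomial, which becomes a multiple of another monomial, so general vectors never have to be
  computed.\<close>

definition amplitude :: "mode multiset \<Rightarrow> (nat \<times> nat \<times> int) list \<Rightarrow> real" where
  "amplitude \<mu> xs = fock_inner (mono_vec \<mu>) (op_prod (map alpha_op xs) vacuum)"

lemma create_mono: "create x (mono_vec \<mu>) = mono_vec (add_mset x \<mu>)"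
  by (simp add: create_def mono_vec_def mult_single)

lemma annihilate_mono:
  "annihilate x (mono_vec \<mu>) = (if x \<in># \<mu>
     then Poly_Mapping.map ((*) (real (snd (snd x)) * real (count \<mu> x))) (mono_vec (\<mu> - {#x#})) else 0)"
proof (rule poly_mapping_eqI)
  fix \<nu>
  have "\<mu> = add_mset x \<nu> \<longleftrightarrow> x \<in># \<mu> \<and> \<nu> = \<mu> - {#x#}"
    by (metis add_mset_remove_trivial insert_DiffM multi_member_this union_single_eq_member)
  thus "Poly_Mapping.lookup (annihilate x (mono_vec \<mu>)) \<nu> = Poly_Mapping.lookup (if x \<in># \<mu>
     then Poly_Mapping.map ((*) (real (snd (snd x)) * real (count \<mu> x))) (mono_vec (\<mu> - {#x#})) else 0) \<nu>"
    by (auto simp: mono_vec_def annihilate.rep_eq lookup_single map.rep_eq when_def)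
qed

lemma amplitude_Nil: "amplitude \<mu> [] = (if \<mu> = {#} then 1 else 0)"
  by (simp add: amplitude_def mono_vec_def vacuum_def fock_inner_def lookup_one mono_normsq_def when_def)

lemma amplitude_annihilator:
  assumes "m > 0"
  shows "amplitude \<mu> ((k, j, m) # xs) = amplitude (add_mset (k, j, nat m) \<mu>) xs"
proof -
  have "amplitude \<mu> ((k, j, m) # xs) =
      fock_inner (alpha k j (- m) (mono_vec \<mu>)) (op_prod (map alpha_op xs) vacuum)"
    by (simp add: amplitude_def alpha_op_def alpha_adjoint)
  thus ?thesis using assms by (simp add: alpha_def create_mono amplitude_def)
qed

lemma amplitude_creator:
  assumes "m < 0" and x: "x = (k, j, nat (- m))"
  shows "amplitude \<mu> ((k, j, m) # xs) =
    (if x \<in># \<mu> then of_int (- m) * real (count \<mu> x) * amplitude (\<mu> - {#x#}) xs else 0)"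
proof -
  let ?u = "op_prod (map alpha_op xs) vacuum"
  have "amplitude \<mu> ((k, j, m) # xs) = fock_inner (alpha k j (- m) (mono_vec \<mu>)) ?u"
    by (simp add: amplitude_def alpha_op_def alpha_adjoint)
  also have "\<dots> = fock_inner ?u (annihilate x (mono_vec \<mu>))"
    using assms by (simp add: alpha_def fock_inner_commute)
  finally show ?thesis
    using assms by (simp add: annihilate_mono fock_inner_scale_right amplitude_def
      fock_inner_commute[of "mono_vec _"])
qed

text \<open>Operators belonging to different edges act on different modes, so the amplitude factors.\<close>

lemma amplitude_factor:
  assumes "finite K" "fst ` set xs \<subseteq> K" "fst ` set_mset \<mu> \<subseteq> K" "\<And>x. x \<in> set xs \<Longrightarrow> snd (snd x) \<noteq> 0"
  shows "amplitude \<mu> xs =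
    (\<Prod>k\<in>K. amplitude (filter_mset (\<lambda>x. fst x = k) \<mu>) (filter (\<lambda>x. fst x = k) xs))"
  using assms(2-)
proof (induction xs arbitrary: \<mu>)
  case Nil
  show ?case
  proof (cases "\<mu> = {#}")
    case False
    then obtain x where x: "x \<in># \<mu>" by blast
    hence "filter_mset (\<lambda>y. fst y = fst x) \<mu> \<noteq> {#}" "fst x \<in> K"
      using Nil.prems by (auto simp: filter_mset_eq_conv)
    thus ?thesis using False assms(1) by (auto simp: amplitude_Nil intro!: prod_zero)
  qed (simp add: amplitude_Nil)
next
  case (Cons y xs)
  obtain k j m where y: "y = (k, j, m)" by (cases y)
  have k: "k \<in> K" and m: "m \<noteq> 0"
    using Cons.prems(1) Cons.prems(3)[of y] by (auto simp: y)
  let ?F = "\<lambda>\<mu> xs k. amplitude (filter_mset (\<lambda>x. fst x = k) \<mu>) (filter (\<lambda>x. fst x = k) xs)"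
  have rest: "(\<Prod>k'\<in>K - {k}. ?F \<mu> (y # xs) k') = (\<Prod>k'\<in>K - {k}. ?F \<nu> xs k')"
    if "\<And>k'. k' \<noteq> k \<Longrightarrow> filter_mset (\<lambda>x. fst x = k') \<nu> = filter_mset (\<lambda>x. fst x = k') \<mu>" for \<nu>
    by (rule prod.cong) (auto simp: y that)
  have split: "(\<Prod>k'\<in>K. f k') = f k * (\<Prod>k'\<in>K - {k}. f k')" for f :: "nat \<Rightarrow> real"
    using assms(1) k by (rule prod.remove)
  show ?case
  proof (cases "m > 0")
    case True
    let ?\<nu> = "add_mset (k, j, nat m) \<mu>"
    have "amplitude \<mu> (y # xs) = amplitude ?\<nu> xs"
      using True by (simp add: y amplitude_annihilator)
    also have "\<dots> = (\<Prod>k\<in>K. ?F ?\<nu> xs k)"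
      using Cons.prems k by (intro Cons.IH) auto
    also have "\<dots> = ?F ?\<nu> xs k * (\<Prod>k'\<in>K - {k}. ?F \<mu> (y # xs) k')"
      by (subst split, subst rest[of ?\<nu>]) simp_all
    also have "?F ?\<nu> xs k = ?F \<mu> (y # xs) k"
      using True by (simp add: y amplitude_annihilator)
    finally show ?thesis unfolding split .
  next
    case False
    hence neg: "m < 0" using m by simp
    let ?x = "(k, j, nat (- m))"
    show ?thesis
    proof (cases "?x \<in># \<mu>")
      case True
      let ?\<nu> = "\<mu> - {#?x#}"
      have \<nu>: "set_mset ?\<nu> \<subseteq> set_mset \<mu>" by (auto dest: in_diffD)
      hence \<nu>K: "fst ` set_mset ?\<nu> \<subseteq> K" using Cons.prems(2) by (meson image_mono subset_trans)
      have filt: "filter_mset (\<lambda>x. fst x = k') ?\<nu> =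
          filter_mset (\<lambda>x. fst x = k') \<mu> - (if k' = k then {#?x#} else {#})" for k'
        by simp
      have "amplitude \<mu> (y # xs) = of_int (- m) * real (count \<mu> ?x) * amplitude ?\<nu> xs"
        using neg True by (simp add: y amplitude_creator)
      also have "amplitude ?\<nu> xs = (\<Prod>k\<in>K. ?F ?\<nu> xs k)"
        using Cons.prems(1,3) \<nu>K by (intro Cons.IH) auto
      also have "\<dots> = ?F ?\<nu> xs k * (\<Prod>k'\<in>K - {k}. ?F \<mu> (y # xs) k')"
        by (subst split, subst rest[of ?\<nu>]) (simp_all add: filt)
      also have "of_int (- m) * real (count \<mu> ?x) * \<dots> =
          (of_int (- m) * real (count \<mu> ?x) * ?F ?\<nu> xs k) * (\<Prod>k'\<in>K - {k}. ?F \<mu> (y # xs) k')"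
        by simp
      also have "of_int (- m) * real (count \<mu> ?x) * ?F ?\<nu> xs k = ?F \<mu> (y # xs) k"
        using neg True by (simp add: y amplitude_creator filt)
      finally show ?thesis unfolding split .
    next
      case notin: False
      hence "?F \<mu> (y # xs) k = 0" using neg by (simp add: y amplitude_creator)
      hence "(\<Prod>k\<in>K. ?F \<mu> (y # xs) k) = 0" using assms(1) k by (intro prod_zero bexI[of _ k])
      moreover have "amplitude \<mu> (y # xs) = 0" using neg notin by (simp add: y amplitude_creator)
      ultimately show ?thesis by simp
    qed
  qed
qed

section \<open>The amplitude of a single edge\<close>

text \<open>Distinct slots give every mode multiplicity one, so each creator contributes just its
  energy \<open>w\<close>.\<close>

lemma amplitude_creators:
  assumes "w > 0" "distinct ls"
  shows "amplitude \<mu> (map (\<lambda>l. (k, l, - int w)) ls) =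
    (if \<mu> = mset (map (\<lambda>l. (k, l, w)) ls) then real w ^ length ls else 0)"
  using assms(2)
proof (induction ls arbitrary: \<mu>)
  case Nil
  show ?case by (simp add: amplitude_Nil)
next
  case (Cons l ls)
  let ?M = "mset (map (\<lambda>l. (k, l, w)) ls)"
  have l: "(k, l, w) \<notin># ?M" using Cons.prems by auto
  have "amplitude \<mu> (map (\<lambda>l. (k, l, - int w)) (l # ls)) =
    (if (k, l, w) \<in># \<mu> then real w * real (count \<mu> (k, l, w)) *
       amplitude (\<mu> - {#(k, l, w)#}) (map (\<lambda>l. (k, l, - int w)) ls) else 0)"
    using assms(1) by (simp add: amplitude_creator)
  also have "\<dots> = (if \<mu> = add_mset (k, l, w) ?M then real w ^ length (l # ls) else 0)"
  proof (cases "(k, l, w) \<in># \<mu>")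
    case True
    then obtain \<nu> where \<nu>: "\<mu> = add_mset (k, l, w) \<nu>" by (metis insert_DiffM)
    show ?thesis
      using l Cons by (auto simp: \<nu> not_in_iff)
  qed auto
  finally show ?case by simp
qed

text \<open>The left vector has slot 1 and the right one slot \<open>c + 1\<close>; all other modes
  agree. The two letters must make up the difference, one annihilating slot \<open>c + 1\<close> and
  the other creating slot 1, both with energy \<open>w\<close>. That creator yields a factor
  \<open>w\<close>, and the right vector yields \<open>w ^ c\<close>.\<close>

lemma amplitude_edge_winding:
  fixes m\<^sub>1 m\<^sub>2 :: int
  assumes "c \<ge> 1" "w > 0" "m\<^sub>1 \<noteq> 0" "m\<^sub>2 \<noteq> 0"
  shows "amplitude (mset (map (\<lambda>l. (k, l, w)) [1..<c + 1]))
      ((k, if m\<^sub>1 > 0 then c + 1 else 1, m\<^sub>1) # (k, if m\<^sub>2 > 0 then c + 1 else 1, m\<^sub>2) #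
        map (\<lambda>l. (k, l, - int w)) [2..<c + 2]) =
    (if m\<^sub>1 = - m\<^sub>2 \<and> \<bar>m\<^sub>1\<bar> = int w then real w * real w ^ c else 0)"
proof -
  \<comment> \<open>The modes common to both vectors, slots 2 to \<open>c\<close>.\<close>
  define C where "C = mset (map (\<lambda>l. (k, l, w)) [2..<c + 1])"
  have C: "(k, 1, x) \<notin># C" "(k, Suc c, x) \<notin># C" "(k, Suc 0, x) \<notin># C" for x
    by (auto simp: C_def)
  have "[1..<c + 1] = 1 # [2..<c + 1]"
    using assms(1) by (simp add: upt_conv_Cons numeral_2_eq_2)
  hence A: "mset (map (\<lambda>l. (k, l, w)) [1..<c + 1]) = add_mset (k, 1, w) C"
    by (simp add: C_def)
  have "[2..<c + 2] = [2..<c + 1] @ [c + 1]"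
    using assms(1) by simp
  hence R: "mset (map (\<lambda>l. (k, l, w)) [2..<c + 2]) = add_mset (k, c + 1, w) C"
    by (simp add: C_def)
  define xs where "xs = map (\<lambda>l. (k, l, - int w)) [2..<c + 2]"
  have tail: "amplitude \<mu> xs =
      (if \<mu> = add_mset (k, c + 1, w) C then real w ^ c else 0)" for \<mu>
    unfolding xs_def amplitude_creators[OF assms(2) distinct_upt] R by (simp only: length_upt diff_add_inverse2)
  consider "m\<^sub>1 > 0" "m\<^sub>2 > 0" | "m\<^sub>1 > 0" "m\<^sub>2 < 0" | "m\<^sub>1 < 0" "m\<^sub>2 > 0" | "m\<^sub>1 < 0" "m\<^sub>2 < 0"
    using assms(3,4) by linarith
  thus ?thesis
  proof cases
    case 1
    \<comment> \<open>Moved to the left, two annihilators add two modes, which the right vector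
      cannot match.\<close>
    have "size (add_mset (k, c + 1, nat m\<^sub>2) (add_mset (k, c + 1, nat m\<^sub>1) (add_mset (k, 1, w) C))) \<noteq>
        size (add_mset (k, c + 1, w) C)" by simp
    hence "add_mset (k, c + 1, nat m\<^sub>2) (add_mset (k, c + 1, nat m\<^sub>1) (add_mset (k, 1, w) C)) \<noteq>
        add_mset (k, c + 1, w) C" by metis
    thus ?thesis unfolding A xs_def[symmetric] using 1 by (simp add: amplitude_annihilator tail)
  next
    case 2
    let ?\<nu> = "add_mset (k, c + 1, nat m\<^sub>1) (add_mset (k, 1, w) C)"
    \<comment> \<open>Slot 1 contains only the mode of energy \<open>w\<close>: \<open>C\<close>
      starts at slot 2, and \<open>c + 1\<close> differs from 1.\<close>
    have mem: "(k, 1, nat (- m\<^sub>2)) \<in># ?\<nu> \<longleftrightarrow> nat (- m\<^sub>2) = w"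
      using C assms(1) by auto
    show ?thesis
    proof (cases "nat (- m\<^sub>2) = w")
      case True
      hence m2: "m\<^sub>2 = - int w" using 2 by simp
      have "count ?\<nu> (k, 1, w) = 1" using C assms(1) by (simp add: not_in_iff)
      moreover have "?\<nu> - {#(k, 1, w)#} = add_mset (k, c + 1, nat m\<^sub>1) C" by simp
      moreover have "add_mset (k, c + 1, nat m\<^sub>1) C = add_mset (k, c + 1, w) C \<longleftrightarrow> m\<^sub>1 = int w"
        using 2 by auto
      moreover have "amplitude (add_mset (k, 1, w) C) ((k, c + 1, m\<^sub>1) # (k, 1, m\<^sub>2) # xs) =
          of_int (- m\<^sub>2) * real (count ?\<nu> (k, 1, w)) * amplitude (?\<nu> - {#(k, 1, w)#}) xs"
        unfolding amplitude_annihilator[OF 2(1)]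
        by (subst amplitude_creator[OF 2(2), of "(k, 1, w)"]) (use m2 in auto)
      ultimately have "amplitude (add_mset (k, 1, w) C) ((k, c + 1, m\<^sub>1) # (k, 1, m\<^sub>2) # xs) =
          (if m\<^sub>1 = int w then real w * real w ^ c else 0)"
        by (simp only: tail) (simp add: m2)
      thus ?thesis
        unfolding A xs_def[symmetric] using 2 m2 by simp
    next
      case False
      hence cond: "\<not> (m\<^sub>1 = - m\<^sub>2 \<and> \<bar>m\<^sub>1\<bar> = int w)" using 2 by linarith
      have slots: "(if m\<^sub>1 > 0 then c + 1 else 1) = c + 1" "(if m\<^sub>2 > 0 then c + 1 else 1) = 1"
        using 2 by simp_all
      have "(k, 1, nat (- m\<^sub>2)) \<notin># ?\<nu>" using mem False by blast
      thus ?thesis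
        unfolding A xs_def[symmetric] if_not_P[OF cond] slots
          amplitude_annihilator[OF 2(1)] amplitude_creator[OF 2(2) refl] by (rule if_not_P)
    qed
  next
    case 3
    let ?\<nu> = "add_mset (k, 1, w) C"
    have mem: "(k, 1, nat (- m\<^sub>1)) \<in># ?\<nu> \<longleftrightarrow> nat (- m\<^sub>1) = w"
      using C assms(1) by auto
    show ?thesis
    proof (cases "nat (- m\<^sub>1) = w")
      case True
      hence m1: "m\<^sub>1 = - int w" using 3 by simp
      have "count ?\<nu> (k, 1, w) = 1" using C assms(1) by (simp add: not_in_iff)
      moreover have "add_mset (k, c + 1, nat m\<^sub>2) C = add_mset (k, c + 1, w) C \<longleftrightarrow> m\<^sub>2 = int w"
        using 3 by auto
      moreover have "amplitude (add_mset (k, 1, w) C) ((k, 1, m\<^sub>1) # (k, c + 1, m\<^sub>2) # xs) =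
          of_int (- m\<^sub>1) * real (count ?\<nu> (k, 1, w)) * amplitude (add_mset (k, c + 1, nat m\<^sub>2) C) xs"
        unfolding amplitude_annihilator[OF 3(2), symmetric]
        by (subst amplitude_creator[OF 3(1), of "(k, 1, w)"]) (use m1 in auto)
      ultimately have "amplitude (add_mset (k, 1, w) C) ((k, 1, m\<^sub>1) # (k, c + 1, m\<^sub>2) # xs) =
          (if m\<^sub>2 = int w then real w * real w ^ c else 0)"
        by (simp only: tail) (simp add: m1)
      thus ?thesis
        unfolding A xs_def[symmetric] using 3 m1 by simp
    next
      case False
      hence cond: "\<not> (m\<^sub>1 = - m\<^sub>2 \<and> \<bar>m\<^sub>1\<bar> = int w)" using 3 by linarith
      have slots: "(if m\<^sub>1 > 0 then c + 1 else 1) = 1" "(if m\<^sub>2 > 0 then c + 1 else 1) = c + 1"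
        using 3 by simp_all
      have "(k, 1, nat (- m\<^sub>1)) \<notin># ?\<nu>" using mem False by blast
      thus ?thesis
        unfolding A xs_def[symmetric] if_not_P[OF cond] slots
          amplitude_creator[OF 3(1) refl] by (rule if_not_P)
    qed
  next
    case 4
    \<comment> \<open>Slot 1 is occupied once, so it cannot be emptied twice.\<close>
    have gone: "(k, 1, nat (- m\<^sub>2)) \<notin># add_mset (k, 1, w) C - {#(k, 1, nat (- m\<^sub>1))#}"
      if x: "(k, 1, nat (- m\<^sub>1)) \<in># add_mset (k, 1, w) C"
    proof -
      have "nat (- m\<^sub>1) = w" using C x by auto
      hence "add_mset (k, 1, w) C - {#(k, 1, nat (- m\<^sub>1))#} = C" by simp
      thus ?thesis using C(1) by metis
    qed
    have cond: "\<not> (m\<^sub>1 = - m\<^sub>2 \<and> \<bar>m\<^sub>1\<bar> = int w)" using 4 by linarith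
    have slots: "(if m\<^sub>1 > 0 then c + 1 else 1) = 1" "(if m\<^sub>2 > 0 then c + 1 else 1) = 1"
      using 4 by simp_all
    show ?thesis
      unfolding A xs_def[symmetric] if_not_P[OF cond] slots
        amplitude_creator[OF 4(1) refl] amplitude_creator[OF 4(2) refl]
      using gone by (cases "(k, 1, nat (- m\<^sub>1)) \<in># add_mset (k, 1, w) C")
        (simp_all only: if_True if_False mult_zero_right simp_thms)
  qed
qed

text \<open>Between two vacua, the left letter has to annihilate what the right letter creates; this
  singles out one direction.\<close>

lemma amplitude_edge_flat:
  fixes m\<^sub>1 m\<^sub>2 :: int
  assumes "m\<^sub>1 \<noteq> 0" "m\<^sub>2 \<noteq> 0"
  shows "amplitude {#} [(k, 1, m\<^sub>1), (k, 1, m\<^sub>2)] = (if m\<^sub>1 = - m\<^sub>2 \<and> m\<^sub>1 > 0 then of_int \<bar>m\<^sub>1\<bar> else 0)"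
proof -
  consider "m\<^sub>1 < 0" | "m\<^sub>1 > 0" "m\<^sub>2 > 0" | "m\<^sub>1 > 0" "m\<^sub>2 < 0"
    using assms by linarith
  thus ?thesis
    by cases (auto simp: amplitude_creator[OF _ refl] amplitude_annihilator amplitude_Nil)
qed

lemma op_prod_creators:
  assumes "\<And>x. x \<in> set xs \<Longrightarrow> snd (snd x) > 0"
  shows "op_prod (map alpha_op (map (\<lambda>(k, l, n). (k, l, - int n)) xs)) vacuum = mono_vec (mset xs)"
  using assms
proof (induction xs)
  case Nil
  show ?case by (simp add: vacuum_def mono_vec_def)
next
  case (Cons x xs)
  have "op_prod (map alpha_op (map (\<lambda>(k, l, n). (k, l, - int n)) xs)) vacuum = mono_vec (mset xs)"
    using Cons by simp
  moreover have "snd (snd x) > 0" using Cons.prems by simp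
  ultimately show ?case
    by (cases x) (simp add: alpha_op_Pair alpha_def create_mono del: map_map)
qed

lemma filter_concat_key:
  assumes "distinct ks" "\<And>k' x. k' \<in> set ks \<Longrightarrow> x \<in> set (g k') \<Longrightarrow> fst x = k'"
  shows "filter (\<lambda>x. fst x = k) (concat (map g ks)) = (if k \<in> set ks then g k else [])"
  using assms
proof (induction ks)
  case (Cons k' ks)
  have "filter (\<lambda>x. fst x = k) (g k') = (if k = k' then g k' else [])"
    using Cons.prems(2) by (auto intro!: filter_True filter_False)
  thus ?case using Cons by auto
qed simp

lemma op_prod_alpha_op_additive:
  "op_prod (map alpha_op xs) 0 = 0"
  "op_prod (map alpha_op xs) (v + w) = op_prod (map alpha_op xs) v + op_prod (map alpha_op xs) w"
  by (induction xs) (auto simp: alpha_op_def alpha_zero alpha_add)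

section \<open>Truncation of the cut-join operator\<close>

text \<open>A finite part of the index set of \<open>cut_join\<close>, the same for all vertices and
  vectors.\<close>

definition triples :: "nat \<Rightarrow> (int \<times> int \<times> int) set" where
  "triples B = {(m\<^sub>1, m\<^sub>2, m\<^sub>3). m\<^sub>1 \<noteq> 0 \<and> m\<^sub>2 \<noteq> 0 \<and> m\<^sub>3 \<noteq> 0 \<and> m\<^sub>1 + m\<^sub>2 + m\<^sub>3 = 0 \<and>
     \<bar>m\<^sub>1\<bar> \<le> int B \<and> \<bar>m\<^sub>2\<bar> \<le> int B \<and> \<bar>m\<^sub>3\<bar> \<le> int B}"

lemma finite_triples: "finite (triples B)"
proof (rule finite_subset)
  show "triples B \<subseteq> {- int B..int B} \<times> {- int B..int B} \<times> {- int B..int B}"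
    by (auto simp: triples_def)
qed auto

definition vertex_word ::
  "(nat \<Rightarrow> nat) \<Rightarrow> (nat \<Rightarrow> nat) \<Rightarrow> (nat \<Rightarrow> nat) \<Rightarrow> int \<times> int \<times> int \<Rightarrow> (nat \<times> nat \<times> int) list" where
  "vertex_word a w q t = (case t of (m\<^sub>1, m\<^sub>2, m\<^sub>3) \<Rightarrow>
     map (\<lambda>(k, m). (k, cut_join_slot a w k m, m)) [(q 1, m\<^sub>1), (q 2, m\<^sub>2), (q 3, m\<^sub>3)])"

text \<open>For a fixed \<open>v\<close> only finitely many summands are nonzero, and every large
  enough box contains them; the threshold depends on \<open>v\<close>.\<close>

lemma cut_join_eventually:
  assumes "q 1 \<noteq> q 2" "q 1 \<noteq> q 3" "q 2 \<noteq> q 3"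
  shows "\<forall>\<^sub>F B in sequentially.
    cut_join a w q v = (\<Sum>t\<in>triples B. op_prod (map alpha_op (vertex_word a w q t)) v)"
proof -
  let ?S = "{(m\<^sub>1, m\<^sub>2, m\<^sub>3). cut_join_term a w q m\<^sub>1 m\<^sub>2 m\<^sub>3 v \<noteq> 0 \<and>
    m\<^sub>1 \<noteq> 0 \<and> m\<^sub>2 \<noteq> 0 \<and> m\<^sub>3 \<noteq> 0 \<and> m\<^sub>1 + m\<^sub>2 + m\<^sub>3 = 0}"
  have "\<forall>\<^sub>F B in sequentially. t \<in> triples B" if "t \<in> ?S" for t
  proof -
    obtain m\<^sub>1 m\<^sub>2 m\<^sub>3 where t: "t = (m\<^sub>1, m\<^sub>2, m\<^sub>3)" by (cases t)
    have "t \<in> triples B" if "B \<ge> nat (\<bar>m\<^sub>1\<bar> + \<bar>m\<^sub>2\<bar> + \<bar>m\<^sub>3\<bar>)" for B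
      using \<open>t \<in> ?S\<close> that by (auto simp: triples_def t)
    thus ?thesis unfolding eventually_sequentially by blast
  qed
  hence "\<forall>\<^sub>F B in sequentially. \<forall>t\<in>?S. t \<in> triples B"
    by (intro eventually_ball_finite finite_cut_join assms) blast
  thus ?thesis
  proof (rule eventually_mono)
    fix B assume B: "\<forall>t\<in>?S. t \<in> triples B"
    have "cut_join a w q v = (\<Sum>(m\<^sub>1, m\<^sub>2, m\<^sub>3)\<in>triples B. cut_join_term a w q m\<^sub>1 m\<^sub>2 m\<^sub>3 v
        when m\<^sub>1 \<noteq> 0 \<and> m\<^sub>2 \<noteq> 0 \<and> m\<^sub>3 \<noteq> 0 \<and> m\<^sub>1 + m\<^sub>2 + m\<^sub>3 = 0)"
      unfolding cut_join_def using B
      by (intro Sum_any.expand_superset finite_triples) (auto simp: when_def split: if_splits)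
    also have "\<dots> = (\<Sum>t\<in>triples B. op_prod (map alpha_op (vertex_word a w q t)) v)"
      by (intro sum.cong) (auto simp: triples_def vertex_word_def cut_join_term_def alpha_op_def)
    finally show "cut_join a w q v = (\<Sum>t\<in>triples B. op_prod (map alpha_op (vertex_word a w q t)) v)" .
  qed
qed


section \<open>Expansion into flows\<close>

locale feynman_operators = circle_graph +
  fixes q :: "nat \<Rightarrow> nat \<Rightarrow> nat"
  assumes adjacent: "\<And>i. i \<in> {1..n} \<Longrightarrow> bij_betw (q i) {1..3} {k \<in> {1..r}. i \<in> ends k}"
begin

section \<open>The words of the states and of the product\<close>

definition vertex_list :: "nat list" where
  "vertex_list = map (inv \<Omega>) [1..<n + 1]"

lemma vertex_list: "distinct vertex_list" "set vertex_list = {1..n}"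
proof -
  have "inj (inv \<Omega>)" using permutes_inj[OF permutes_inv[OF order]] .
  thus "distinct vertex_list"
    by (simp add: vertex_list_def distinct_map inj_on_subset[OF _ subset_UNIV])
  have "set [1..<n + 1] = {1..n}" by auto
  thus "set vertex_list = {1..n}"
    unfolding vertex_list_def set_map using permutes_image[OF permutes_inv[OF order]] by simp
qed

text \<open>The left vector is kept as a list of modes and the right one as a word, matching the two
  arguments of \<open>amplitude\<close>.\<close>

definition left_modes :: "(nat \<Rightarrow> nat) \<Rightarrow> mode list" where
  "left_modes w = concat (map (\<lambda>k. map (\<lambda>l. (k, l, w k)) [1..<a k div w k + 1]) [1..<r + 1])"

definition right_word :: "(nat \<Rightarrow> nat) \<Rightarrow> (nat \<times> nat \<times> int) list" where
  "right_word w =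
     concat (map (\<lambda>k. map (\<lambda>l. (k, l, - int (w k))) [2..<a k div w k + 2]) [1..<r + 1])"

definition vertices_word :: "(nat \<Rightarrow> nat) \<Rightarrow> (nat \<Rightarrow> int \<times> int \<times> int) \<Rightarrow> (nat \<times> nat \<times> int) list" where
  "vertices_word w f = concat (map (\<lambda>i. vertex_word a w (q i) (f i)) vertex_list)"

lemma divisor_tuples_pos:
  assumes "w \<in> divisor_tuples r a" "k \<in> {1..r}" "a k > 0"
  shows "w k > 0" "w k dvd a k"
  using assms by (auto simp: divisor_tuples_def)

lemma left_state_eq:
  assumes "w \<in> divisor_tuples r a"
  shows "left_state r a w = mono_vec (mset (left_modes w))"
proof -
  have "snd (snd x) > 0" if x: "x \<in> set (left_modes w)" for x
  proof -
    obtain k l where kl: "k \<in> {1..r}" "l \<in> {1..<a k div w k + 1}" "x = (k, l, w k)"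
      using x by (auto simp: left_modes_def)
    \<comment> \<open>A zero value would make the quotient 0 and the range of \<open>l\<close>
      empty.\<close>
    hence "w k \<noteq> 0" by (intro notI) simp
    thus ?thesis using kl by simp
  qed
  from op_prod_creators[of "left_modes w", OF this] show ?thesis
    by (simp add: left_state_def left_modes_def map_concat o_def alpha_op_Pair del: upt_Suc)
qed

lemma right_state_eq: "right_state r a w = op_prod (map alpha_op (right_word w)) vacuum"
  by (simp add: right_state_def right_word_def map_concat o_def alpha_op_Pair del: upt_Suc)

lemma q_star:
  assumes "i \<in> {1..n}"
  shows "q i 1 \<noteq> q i 2" "q i 1 \<noteq> q i 3" "q i 2 \<noteq> q i 3" "star i = {q i 1, q i 2, q i 3}"
proof -
  have inj: "inj_on (q i) {1..3}" and im: "q i ` {1..3} = star i"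
    using adjacent[OF assms] by (auto simp: bij_betw_def)
  show "q i 1 \<noteq> q i 2" "q i 1 \<noteq> q i 3" "q i 2 \<noteq> q i 3"
    using inj_on_eq_iff[OF inj, of 1 2] inj_on_eq_iff[OF inj, of 1 3] inj_on_eq_iff[OF inj, of 2 3]
    by auto
  have "{1..3} = {1, 2, 3 :: nat}" by auto
  thus "star i = {q i 1, q i 2, q i 3}" using im by simp
qed

lemma matrix_element_expand:
  assumes "w \<in> divisor_tuples r a"
  shows "\<forall>\<^sub>F B in sequentially. matrix_element (left_state r a w)
      (op_prod (map (\<lambda>j. cut_join a w (q (inv \<Omega> j))) [1..<n + 1])) (right_state r a w) =
    (\<Sum>f\<in>{1..n} \<rightarrow>\<^sub>E triples B. amplitude (mset (left_modes w)) (vertices_word w f @ right_word w))"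
proof -
  let ?A = "\<lambda>i t. op_prod (map alpha_op (vertex_word a w (q i) t))"
  let ?R = "right_state r a w"
  have "\<forall>\<^sub>F B in sequentially. op_prod (map (\<lambda>i. cut_join a w (q i)) vertex_list) ?R =
      op_prod (map (\<lambda>i v. \<Sum>t\<in>triples B. ?A i t v) vertex_list) ?R"
  proof (rule op_prod_eventually)
    fix i v assume "i \<in> set vertex_list"
    hence "i \<in> {1..n}" by (simp add: vertex_list)
    thus "\<forall>\<^sub>F B in sequentially. cut_join a w (q i) v = (\<Sum>t\<in>triples B. ?A i t v)"
      by (intro cut_join_eventually q_star)
  qed
  thus ?thesis
  proof (rule eventually_mono)
    fix B assume B: "op_prod (map (\<lambda>i. cut_join a w (q i)) vertex_list) ?R =
      op_prod (map (\<lambda>i v. \<Sum>t\<in>triples B. ?A i t v) vertex_list) ?R"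
    have "op_prod (map (\<lambda>j. cut_join a w (q (inv \<Omega> j))) [1..<n + 1]) ?R =
        op_prod (map (\<lambda>i. cut_join a w (q i)) vertex_list) ?R"
      by (simp add: vertex_list_def o_def del: upt_Suc)
    also have "\<dots> = (\<Sum>f\<in>set vertex_list \<rightarrow>\<^sub>E triples B. op_prod (map (\<lambda>i. ?A i (f i)) vertex_list) ?R)"
      unfolding B by (rule op_prod_sum) (simp_all add: vertex_list op_prod_alpha_op_additive)
    also have "\<dots> = (\<Sum>f\<in>{1..n} \<rightarrow>\<^sub>E triples B.
        op_prod (map alpha_op (vertices_word w f @ right_word w)) vacuum)"
      by (simp add: vertex_list vertices_word_def map_concat o_def op_prod_concat right_state_eq)
    finally show "matrix_element (left_state r a w)
      (op_prod (map (\<lambda>j. cut_join a w (q (inv \<Omega> j))) [1..<n + 1])) ?R =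
      (\<Sum>f\<in>{1..n} \<rightarrow>\<^sub>E triples B. amplitude (mset (left_modes w)) (vertices_word w f @ right_word w))"
      by (simp only: matrix_element_def left_state_eq[OF assms] fock_inner_sum_right amplitude_def)
  qed
qed

text \<open>The integer that the choice \<open>f\<close> of summands assigns to the edge \<open>k\<close> at the vertex \<open>i\<close>.\<close>

definition flag_value :: "(nat \<Rightarrow> int \<times> int \<times> int) \<Rightarrow> nat \<Rightarrow> nat \<Rightarrow> int" where
  "flag_value f i k = (case f i of (m\<^sub>1, m\<^sub>2, m\<^sub>3) \<Rightarrow>
     if k = q i 1 then m\<^sub>1 else if k = q i 2 then m\<^sub>2 else m\<^sub>3)"

lemma flag_value_q:
  assumes "i \<in> {1..n}"
  shows "f i = (flag_value f i (q i 1), flag_value f i (q i 2), flag_value f i (q i 3))"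
  using q_star(1-3)[OF assms] by (auto simp: flag_value_def split: prod.splits)

lemma sum_star:
  assumes "i \<in> {1..n}"
  shows "(\<Sum>k\<in>star i. g k) = g (q i 1) + g (q i 2) + (g (q i 3) :: int)"
  unfolding q_star(4)[OF assms] using q_star(1-3)[OF assms] by simp

text \<open>The zero-sum condition of the cut-join operator, read on the star of \<open>i\<close>,
  is the vertex condition of a flow.\<close>

lemma in_triples_iff:
  assumes "i \<in> {1..n}"
  shows "f i \<in> triples B \<longleftrightarrow> (\<Sum>k\<in>star i. flag_value f i k) = 0 \<and>
    (\<forall>k\<in>star i. flag_value f i k \<noteq> 0 \<and> \<bar>flag_value f i k\<bar> \<le> int B)"
proof -
  have "f i \<in> triples B \<longleftrightarrow>
      (flag_value f i (q i 1), flag_value f i (q i 2), flag_value f i (q i 3)) \<in> triples B"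
    using flag_value_q[OF assms, of f] by simp
  also have "\<dots> \<longleftrightarrow> (\<Sum>k\<in>star i. flag_value f i k) = 0 \<and>
    (\<forall>k\<in>{q i 1, q i 2, q i 3}. flag_value f i k \<noteq> 0 \<and> \<bar>flag_value f i k\<bar> \<le> int B)"
    unfolding sum_star[OF assms] by (auto simp: triples_def)
  finally show ?thesis unfolding q_star(4)[OF assms] .
qed

definition flag_op :: "(nat \<Rightarrow> nat) \<Rightarrow> (nat \<Rightarrow> int \<times> int \<times> int) \<Rightarrow> nat \<Rightarrow> nat \<Rightarrow> nat \<times> nat \<times> int" where
  "flag_op w f k i = (k, cut_join_slot a w k (flag_value f i k), flag_value f i k)"

lemma vertex_word_eq:
  assumes "i \<in> {1..n}"
  shows "vertex_word a w (q i) (f i) = map (\<lambda>k. flag_op w f k i) [q i 1, q i 2, q i 3]"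
  by (subst flag_value_q[OF assms]) (simp add: vertex_word_def flag_op_def)

section \<open>The two letters of an edge\<close>

text \<open>In the product, the operator at \<open>early k\<close> stands to the left of the one at
  \<open>late k\<close> and is applied after it.\<close>

definition early :: "nat \<Rightarrow> nat" where
  "early k = (if \<Omega> (lo k) < \<Omega> (hi k) then lo k else hi k)"

definition late :: "nat \<Rightarrow> nat" where
  "late k = (if \<Omega> (lo k) < \<Omega> (hi k) then hi k else lo k)"

lemma early_late:
  assumes k: "k \<in> {1..r}"
  shows "\<Omega> (early k) < \<Omega> (late k)" "i \<in> ends k \<longleftrightarrow> i = early k \<or> i = late k"
    "early k \<in> {1..n}" "late k \<in> {1..n}"
proof -
  have "\<Omega> (lo k) \<noteq> \<Omega> (hi k)"
    using ends(1)[OF k] by (simp add: inj_eq[OF permutes_inj[OF order]])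
  thus "\<Omega> (early k) < \<Omega> (late k)" by (auto simp: early_def late_def)
  show "i \<in> ends k \<longleftrightarrow> i = early k \<or> i = late k"
    unfolding ends(2)[OF k] by (auto simp: early_def late_def)
  show "early k \<in> {1..n}" "late k \<in> {1..n}"
    unfolding early_def late_def using ends(3,4)[OF k] by simp_all
qed

lemma filter_vertex_list:
  assumes k: "k \<in> {1..r}"
  shows "filter (\<lambda>i. k \<in> star i) vertex_list = [early k, late k]"
proof -
  have \<Omega>: "\<Omega> (early k) \<in> {1..n}" "\<Omega> (late k) \<in> {1..n}"
    using Omega_mem early_late(3,4)[OF k] by blast+
  have inv: "inv \<Omega> j = i \<longleftrightarrow> j = \<Omega> i" for i j
    using permutes_inv_eq[OF order, of j i] by auto
  have "filter (\<lambda>j. k \<in> star (inv \<Omega> j)) [1..<n + 1] = [\<Omega> (early k), \<Omega> (late k)]"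
  proof (rule sorted_distinct_set_unique)
    show "set (filter (\<lambda>j. k \<in> star (inv \<Omega> j)) [1..<n + 1]) = set [\<Omega> (early k), \<Omega> (late k)]"
      using k \<Omega> by (auto simp: early_late(2)[OF k] inv)
  qed (use early_late(1)[OF k] in \<open>auto simp: sorted_wrt_filter simp del: upt_Suc\<close>)
  hence "filter (\<lambda>i. k \<in> star i) vertex_list = map (inv \<Omega>) [\<Omega> (early k), \<Omega> (late k)]"
    unfolding vertex_list_def filter_map o_def by simp
  thus ?thesis by (simp add: inv)
qed

text \<open>An edge is used at two distinct vertices, once at each.\<close>

lemma filter_vertices_word:
  assumes k: "k \<in> {1..r}"
  shows "filter (\<lambda>x. fst x = k) (vertices_word w f) = [flag_op w f k (early k), flag_op w f k (late k)]"
proof -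
  have "filter (\<lambda>x. fst x = k) (vertex_word a w (q i) (f i)) =
      (if k \<in> star i then [flag_op w f k i] else [])" if "i \<in> set vertex_list" for i
  proof -
    have i: "i \<in> {1..n}" using that by (simp add: vertex_list)
    show ?thesis
      unfolding vertex_word_eq[OF i] q_star(4)[OF i]
      using q_star(1-3)[OF i] by (auto simp: flag_op_def)
  qed
  moreover have select: "concat (map (\<lambda>i. if Q i then [g i] else []) xs) = map g (filter Q xs)"
    for Q and g :: "nat \<Rightarrow> nat \<times> nat \<times> int" and xs by (induction xs) simp_all
  ultimately have "filter (\<lambda>x. fst x = k) (vertices_word w f) =
      concat (map (\<lambda>i. if k \<in> star i then [flag_op w f k i] else []) vertex_list)"
    unfolding vertices_word_def filter_concat map_map o_def by (intro arg_cong[of _ _ concat] map_cong refl)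
  also have "\<dots> = map (flag_op w f k) (filter (\<lambda>i. k \<in> star i) vertex_list)"
    by (rule select)
  finally show ?thesis by (simp only: filter_vertex_list[OF k] list.map)
qed

section \<open>Edge weights\<close>

text \<open>\<open>x\<close> belongs to the earlier end, whose operator acts last; hence the sign
  condition when \<open>a k = 0\<close>.\<close>

definition edge_weight :: "(nat \<Rightarrow> nat) \<Rightarrow> nat \<Rightarrow> int \<Rightarrow> int \<Rightarrow> real" where
  "edge_weight w k x y =
     (if x = - y \<and> (if a k = 0 then x > 0 else \<bar>x\<bar> = int (w k)) then of_int \<bar>x\<bar> else 0)"

text \<open>The prefactor cancels the power of \<open>w k\<close> that stems from the right vector;
  the one factor left over is the expansion factor.\<close>

lemma amplitude_edge:
  assumes w: "w \<in> divisor_tuples r a" and k: "k \<in> {1..r}" and nz: "x \<noteq> 0" "y \<noteq> 0"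
  shows "(1 / real (w k)) ^ (a k div w k) *
    amplitude (mset (map (\<lambda>l. (k, l, w k)) [1..<a k div w k + 1]))
      ([(k, cut_join_slot a w k x, x), (k, cut_join_slot a w k y, y)] @
       map (\<lambda>l. (k, l, - int (w k))) [2..<a k div w k + 2]) = edge_weight w k x y"
proof (cases "a k = 0")
  case True
  \<comment> \<open>Here \<open>w k\<close> is arbitrary, but \<open>0 div w k = 0\<close> empties
    both ranges.\<close>
  have "amplitude (mset (map (\<lambda>l. (k, l, w k)) [1..<a k div w k + 1]))
      ([(k, cut_join_slot a w k x, x), (k, cut_join_slot a w k y, y)] @
       map (\<lambda>l. (k, l, - int (w k))) [2..<a k div w k + 2]) = amplitude {#} [(k, 1, x), (k, 1, y)]"
    using True by (simp add: cut_join_slot_def)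
  also have "\<dots> = edge_weight w k x y"
    using True unfolding amplitude_edge_flat[OF nz] edge_weight_def by simp
  finally show ?thesis using True by (simp only: div_0 power_0 mult_1)
next
  case False
  hence wk: "w k > 0" "w k dvd a k" using divisor_tuples_pos[OF w k] by auto
  let ?c = "a k div w k"
  have c: "?c \<ge> 1" using False wk by (auto elim!: dvdE)
  have slot: "cut_join_slot a w k m = (if m > 0 then ?c + 1 else 1)" for m
    using False by (simp add: cut_join_slot_def)
  have "(1 / real (w k)) ^ ?c * real (w k) ^ ?c = 1"
    using wk by (simp flip: power_mult_distrib)
  hence scale: "(1 / real (w k)) ^ ?c * (real (w k) * real (w k) ^ ?c) = real (w k)"
    by (simp only: mult.left_commute mult_1_right)
  have ew: "edge_weight w k x y = (if x = - y \<and> \<bar>x\<bar> = int (w k) then of_int \<bar>x\<bar> else 0)"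
    using False by (simp add: edge_weight_def)
  have "(1 / real (w k)) ^ ?c *
      (if x = - y \<and> \<bar>x\<bar> = int (w k) then real (w k) * real (w k) ^ ?c else 0) = edge_weight w k x y"
  proof (cases "x = - y \<and> \<bar>x\<bar> = int (w k)")
    case True
    hence "real_of_int \<bar>x\<bar> = real (w k)" by (metis of_int_of_nat_eq)
    thus ?thesis unfolding ew if_P[OF True] scale ..
  next
    case False
    show ?thesis unfolding ew if_not_P[OF False] by simp
  qed
  thus ?thesis
    unfolding slot append_Cons append_Nil amplitude_edge_winding[OF c wk(1) nz] .
qed

text \<open>Prefactor and amplitude both split into factors over the edges, which pair up to edge
  weights.\<close>

lemma amplitude_eq_prod:
  assumes w: "w \<in> divisor_tuples r a" and f: "\<And>i. i \<in> {1..n} \<Longrightarrow> f i \<in> triples B"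
  shows "(\<Prod>k=1..r. (1 / real (w k)) ^ (a k div w k)) *
      amplitude (mset (left_modes w)) (vertices_word w f @ right_word w) =
    (\<Prod>k=1..r. edge_weight w k (flag_value f (early k) k) (flag_value f (late k) k))"
proof -
  have nz: "flag_value f i k \<noteq> 0" if "i \<in> {1..n}" "k \<in> star i" for i k
    using f[OF that(1)] that unfolding in_triples_iff[OF that(1)] by blast
  have vw: "\<exists>i\<in>{1..n}. \<exists>k\<in>star i. x = flag_op w f k i" if x: "x \<in> set (vertices_word w f)" for x
  proof -
    obtain i where i: "i \<in> {1..n}" "x \<in> set (vertex_word a w (q i) (f i))"
      using x by (auto simp: vertices_word_def vertex_list)
    have "\<exists>k\<in>star i. x = flag_op w f k i"
      using i(2) unfolding vertex_word_eq[OF i(1)] q_star(4)[OF i(1)] by auto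
    thus ?thesis using i(1) by blast
  qed
  have rw: "fst x \<in> {1..r} \<and> snd (snd x) \<noteq> 0" if x: "x \<in> set (right_word w)" for x
  proof -
    obtain k l where kl: "k \<in> {1..r}" "l \<in> {2..<a k div w k + 2}" "x = (k, l, - int (w k))"
      using x by (auto simp: right_word_def)
    hence "w k \<noteq> 0" by (intro notI) simp
    thus ?thesis using kl by simp
  qed
  have key: "amplitude (mset (left_modes w)) (vertices_word w f @ right_word w) =
    (\<Prod>k\<in>{1..r}. amplitude (filter_mset (\<lambda>x. fst x = k) (mset (left_modes w)))
       (filter (\<lambda>x. fst x = k) (vertices_word w f @ right_word w)))"
  proof (rule amplitude_factor)
    show "fst ` set (vertices_word w f @ right_word w) \<subseteq> {1..r}"
    proof (rule image_subsetI)
      fix x assume "x \<in> set (vertices_word w f @ right_word w)"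
      thus "fst x \<in> {1..r}" using vw[of x] rw[of x] by (auto simp: flag_op_def)
    qed
    show "fst ` set_mset (mset (left_modes w)) \<subseteq> {1..r}"
      by (auto simp: left_modes_def)
    fix x assume "x \<in> set (vertices_word w f @ right_word w)"
    thus "snd (snd x) \<noteq> 0" using vw[of x] rw[of x] nz by (auto simp: flag_op_def)
  qed simp
  show ?thesis
    unfolding key prod.distrib[symmetric]
  proof (rule prod.cong[OF refl])
    fix k assume k: "k \<in> {1..r}"
    have ks: "k \<in> set [1..<r + 1]" using k by auto
    have L: "filter_mset (\<lambda>x. fst x = k) (mset (left_modes w)) =
        mset (map (\<lambda>l. (k, l, w k)) [1..<a k div w k + 1])"
      unfolding mset_filter[symmetric] left_modes_def
      by (subst filter_concat_key) (use ks in auto)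
    have R: "filter (\<lambda>x. fst x = k) (right_word w) =
        map (\<lambda>l. (k, l, - int (w k))) [2..<a k div w k + 2]"
      unfolding right_word_def
      by (subst filter_concat_key) (use ks in auto)
    have "flag_value f (early k) k \<noteq> 0" "flag_value f (late k) k \<noteq> 0"
      using nz early_late[OF k] k by auto
    thus "(1 / real (w k)) ^ (a k div w k) *
        amplitude (filter_mset (\<lambda>x. fst x = k) (mset (left_modes w)))
          (filter (\<lambda>x. fst x = k) (vertices_word w f @ right_word w)) =
      edge_weight w k (flag_value f (early k) k) (flag_value f (late k) k)"
      unfolding filter_append L R filter_vertices_word[OF k] flag_op_def
      by (rule amplitude_edge[OF w k])
  qed
qed

section \<open>Choices of summands that come from flows\<close>

definition bounded_flows :: "nat \<Rightarrow> (nat \<Rightarrow> int) set" where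
  "bounded_flows B = {m \<in> flows. \<forall>k\<in>{1..r}. \<bar>m k\<bar> \<le> int B}"

text \<open>The only tuple to whose matrix element the flow contributes.\<close>

definition flow_divisors :: "(nat \<Rightarrow> int) \<Rightarrow> nat \<Rightarrow> nat" where
  "flow_divisors m = (\<lambda>k\<in>{k \<in> {1..r}. a k > 0}. nat \<bar>m k\<bar>)"

text \<open>A positive index annihilates what comes from further right, from a later vertex or from
  beyond p_0. It therefore stands for an edge leaving the vertex along the orientation, which is why
  outflows appear.\<close>

definition flow_choice :: "(nat \<Rightarrow> int) \<Rightarrow> nat \<Rightarrow> int \<times> int \<times> int" where
  "flow_choice m = (\<lambda>i\<in>{1..n}. (outflow m i (q i 1), outflow m i (q i 2), outflow m i (q i 3)))"

lemma finite_bounded_flows: "finite (bounded_flows B)"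
proof (rule finite_subset)
  show "bounded_flows B \<subseteq> {1..r} \<rightarrow>\<^sub>E {- int B..int B}"
  proof (intro subsetI PiE_I)
    fix m k assume m: "m \<in> bounded_flows B"
    show "m k \<in> {- int B..int B}" if "k \<in> {1..r}"
    proof -
      have "\<bar>m k\<bar> \<le> int B" using m that by (simp add: bounded_flows_def)
      thus ?thesis by auto
    qed
    show "m k = undefined" if "k \<notin> {1..r}"
      using m that by (auto simp: bounded_flows_def flows_def intro: extensional_arb)
  qed
qed (simp add: finite_PiE)

lemma flow_divisors_mem: "m \<in> flows \<Longrightarrow> flow_divisors m \<in> divisor_tuples r a"
  using flowsD(1,3)[of m] by (auto simp: flow_divisors_def divisor_tuples_def)

lemma flow_divisors_eq_iff:
  assumes "w \<in> divisor_tuples r a"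
  shows "flow_divisors m = w \<longleftrightarrow> (\<forall>k\<in>{1..r}. a k > 0 \<longrightarrow> \<bar>m k\<bar> = int (w k))"
proof
  assume "\<forall>k\<in>{1..r}. a k > 0 \<longrightarrow> \<bar>m k\<bar> = int (w k)"
  thus "flow_divisors m = w"
    using assms unfolding flow_divisors_def divisor_tuples_def
    by (intro extensionalityI[of _ "{k \<in> {1..r}. a k > 0}"]) (auto simp: PiE_def)
qed (auto simp: flow_divisors_def)

lemma flag_value_flow_choice:
  assumes "i \<in> {1..n}" "k \<in> star i"
  shows "flag_value (flow_choice m) i k = outflow m i k"
  using assms q_star[OF assms(1)] by (auto simp: flag_value_def flow_choice_def)

lemma outflow_late: "k \<in> {1..r} \<Longrightarrow> outflow m (late k) k = - outflow m (early k) k"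
  using ends(1)[of k] by (auto simp: outflow_def early_def late_def)

lemma abs_outflow: "\<bar>outflow m i k\<bar> = \<bar>m k\<bar>"
  by (simp add: outflow_def)

text \<open>Translates the sign condition of \<open>flows\<close>, relative to the labels, into that
  of \<open>edge_weight\<close>, relative to the order.\<close>

lemma outflow_early_pos_iff:
  assumes "k \<in> {1..r}" "m k \<noteq> 0"
  shows "outflow m (early k) k > 0 \<longleftrightarrow> (0 < m k \<longleftrightarrow> \<Omega> (lo k) < \<Omega> (hi k))"
  using assms ends(1)[OF assms(1)] by (auto simp: outflow_def early_def)

lemma flow_choice_mem:
  assumes "m \<in> bounded_flows B"
  shows "flow_choice m \<in> {1..n} \<rightarrow>\<^sub>E triples B"
proof (rule PiE_I)
  fix i assume i: "i \<in> {1..n}"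
  have m: "m \<in> flows" "\<And>k. k \<in> {1..r} \<Longrightarrow> \<bar>m k\<bar> \<le> int B"
    using assms by (auto simp: bounded_flows_def)
  have "(\<Sum>k\<in>star i. flag_value (flow_choice m) i k) = (\<Sum>k\<in>star i. outflow m i k)"
    using flag_value_flow_choice[OF i] by (rule sum.cong[OF refl])
  moreover have "(\<Sum>k\<in>star i. outflow m i k) = 0"
    using m(1) i by (simp add: flows_def conserved_def)
  moreover have "flag_value (flow_choice m) i k \<noteq> 0 \<and> \<bar>flag_value (flow_choice m) i k\<bar> \<le> int B"
    if k: "k \<in> star i" for k
    unfolding flag_value_flow_choice[OF i k] abs_outflow
    using k m(2)[of k] flowsD(1)[OF m(1), of k] by (auto simp: outflow_def)
  ultimately show "flow_choice m i \<in> triples B" unfolding in_triples_iff[OF i] by simp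
qed (auto simp: flow_choice_def restrict_def)

lemma inj_flow_choice: "inj_on flow_choice flows"
proof (rule inj_onI)
  fix m m' assume m: "m \<in> flows" "m' \<in> flows" and eq: "flow_choice m = flow_choice m'"
  have "m k = m' k" if k: "k \<in> {1..r}" for k
  proof -
    have lo: "lo k \<in> {1..n}" "k \<in> star (lo k)" using ends(2)[OF k] ends(3)[OF k] k by auto
    have "outflow m (lo k) k = outflow m' (lo k) k"
      using flag_value_flow_choice[OF lo, of m] flag_value_flow_choice[OF lo, of m'] eq by simp
    thus ?thesis by (simp add: outflow_def)
  qed
  thus "m = m'" using m by (intro extensionalityI[of _ "{1..r}"]) (auto simp: flows_def)
qed

definition choice_weight :: "(nat \<Rightarrow> nat) \<Rightarrow> (nat \<Rightarrow> int \<times> int \<times> int) \<Rightarrow> real" where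
  "choice_weight w f =
     (\<Prod>k=1..r. edge_weight w k (flag_value f (early k) k) (flag_value f (late k) k))"

lemma choice_weight_flow:
  assumes w: "w \<in> divisor_tuples r a" and m: "m \<in> flows" "flow_divisors m = w"
  shows "choice_weight w (flow_choice m) = (\<Prod>k=1..r. real_of_int \<bar>m k\<bar>)"
  unfolding choice_weight_def
proof (rule prod.cong[OF refl])
  fix k assume k: "k \<in> {1..r}"
  have st: "k \<in> star (early k)" "k \<in> star (late k)" using early_late(2)[OF k] k by auto
  have "if a k = 0 then outflow m (early k) k > 0 else \<bar>m k\<bar> = int (w k)"
    using outflow_early_pos_iff[of k m, OF k flowsD(1)[OF m(1) k]] flowsD(2)[OF m(1) k] m(2) k
    unfolding flow_divisors_eq_iff[OF w] by auto
  thus "edge_weight w k (flag_value (flow_choice m) (early k) k) (flag_value (flow_choice m) (late k) k) =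
      real_of_int \<bar>m k\<bar>"
    unfolding flag_value_flow_choice[OF early_late(3)[OF k] st(1)]
      flag_value_flow_choice[OF early_late(4)[OF k] st(2)] outflow_late[OF k] edge_weight_def abs_outflow
    by simp
qed

text \<open>A choice of summands contributes only if its values at the two ends of every edge cancel.\<close>

lemma choice_weight_nonzero:
  assumes w: "w \<in> divisor_tuples r a" and f: "f \<in> {1..n} \<rightarrow>\<^sub>E triples B" and nz: "choice_weight w f \<noteq> 0"
  obtains m where "m \<in> bounded_flows B" "flow_divisors m = w" "f = flow_choice m"
proof -
  define m where "m = (\<lambda>k\<in>{1..r}. flag_value f (lo k) k)"
  have tri: "(\<Sum>k\<in>star i. flag_value f i k) = 0"
    "\<And>k. k \<in> star i \<Longrightarrow> flag_value f i k \<noteq> 0 \<and> \<bar>flag_value f i k\<bar> \<le> int B" if i: "i \<in> {1..n}" for i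
    using PiE_mem[OF f i] unfolding in_triples_iff[OF i] by blast+
  have ew: "flag_value f (early k) k = - flag_value f (late k) k"
    "if a k = 0 then flag_value f (early k) k > 0 else \<bar>flag_value f (early k) k\<bar> = int (w k)"
    if k: "k \<in> {1..r}" for k
  proof -
    have "edge_weight w k (flag_value f (early k) k) (flag_value f (late k) k) \<noteq> 0"
      using nz k unfolding choice_weight_def by (simp add: prod_zero_iff)
    thus "flag_value f (early k) k = - flag_value f (late k) k"
      "if a k = 0 then flag_value f (early k) k > 0 else \<bar>flag_value f (early k) k\<bar> = int (w k)"
      unfolding edge_weight_def by presburger+
  qed
  have fv: "flag_value f i k = outflow m i k" if "k \<in> star i" for i k
  proof -
    have k: "k \<in> {1..r}" "i = lo k \<or> i = hi k" using that ends(2)[of k i] by auto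
    have "flag_value f (hi k) k = - flag_value f (lo k) k"
      using ew(1)[OF k(1)] by (auto simp: early_def late_def split: if_splits)
    thus ?thesis using k by (auto simp: outflow_def m_def)
  qed
  have lo: "lo k \<in> {1..n}" "k \<in> star (lo k)" "k \<in> star (early k)" if k: "k \<in> {1..r}" for k
    using ends(2)[OF k] ends(3)[OF k] early_late(2)[OF k] k by auto
  have mk: "m k \<noteq> 0" "\<bar>m k\<bar> \<le> int B" if k: "k \<in> {1..r}" for k
    using tri(2)[OF lo(1,2)[OF k]] k by (auto simp: m_def)
  have divs: "flow_divisors m = w"
    unfolding flow_divisors_eq_iff[OF w]
    using ew(2) fv lo(3) abs_outflow by (metis less_numeral_extra(3))
  have "conserved m"
    unfolding conserved_def
  proof
    fix i assume i: "i \<in> {1..n}"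
    have "(\<Sum>k\<in>star i. outflow m i k) = (\<Sum>k\<in>star i. flag_value f i k)"
      using fv by (intro sum.cong refl) simp
    thus "(\<Sum>k\<in>star i. outflow m i k) = 0" using tri(1)[OF i] by simp
  qed
  moreover have "if a k = 0 then 0 < m k \<longleftrightarrow> \<Omega> (lo k) < \<Omega> (hi k) else nat \<bar>m k\<bar> dvd a k"
    if k: "k \<in> {1..r}" for k
  proof (cases "a k = 0")
    case True
    thus ?thesis
      using ew(2)[OF k] outflow_early_pos_iff[of k m, OF k mk(1)[OF k]] fv[OF lo(3)[OF k]] by simp
  next
    case False
    hence "\<bar>m k\<bar> = int (w k)" using divs k unfolding flow_divisors_eq_iff[OF w] by blast
    thus ?thesis using False divisor_tuples_pos[OF w k] by simp
  qed
  moreover have "m \<in> extensional {1..r}" by (simp add: m_def)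
  ultimately have "m \<in> bounded_flows B"
    using mk unfolding bounded_flows_def flows_def by blast
  moreover have "f = flow_choice m"
  proof (rule extensionalityI[of _ "{1..n}"])
    fix i assume i: "i \<in> {1..n}"
    have "q i 1 \<in> star i" "q i 2 \<in> star i" "q i 3 \<in> star i" unfolding q_star(4)[OF i] by auto
    from this[THEN fv] show "f i = flow_choice m i"
      using flag_value_q[OF i, of f] i by (simp add: flow_choice_def)
  qed (use f in \<open>auto simp: flow_choice_def PiE_def\<close>)
  ultimately show ?thesis using divs that by blast
qed

text \<open>Choices outside the image of \<open>flow_choice\<close> have weight zero, and each flow
  gives a different choice.\<close>

lemma sum_choice_weight:
  assumes w: "w \<in> divisor_tuples r a"
  shows "(\<Sum>f\<in>{1..n} \<rightarrow>\<^sub>E triples B. choice_weight w f) =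
    (\<Sum>m | m \<in> bounded_flows B \<and> flow_divisors m = w. \<Prod>k=1..r. real_of_int \<bar>m k\<bar>)"
proof -
  let ?S = "{m. m \<in> bounded_flows B \<and> flow_divisors m = w}"
  have S: "?S \<subseteq> flows" by (auto simp: bounded_flows_def)
  have "(\<Sum>f\<in>{1..n} \<rightarrow>\<^sub>E triples B. choice_weight w f) = sum (choice_weight w) (flow_choice ` ?S)"
  proof (rule sum.mono_neutral_right)
    show "finite ({1..n} \<rightarrow>\<^sub>E triples B)" by (simp add: finite_PiE finite_triples)
    show "flow_choice ` ?S \<subseteq> {1..n} \<rightarrow>\<^sub>E triples B" using flow_choice_mem by blast
    show "\<forall>f\<in>({1..n} \<rightarrow>\<^sub>E triples B) - flow_choice ` ?S. choice_weight w f = 0"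
      using choice_weight_nonzero[OF w] by blast
  qed
  also have "\<dots> = (\<Sum>m\<in>?S. choice_weight w (flow_choice m))"
    using inj_on_subset[OF inj_flow_choice S] by (rule sum.reindex_cong) simp_all
  also have "\<dots> = (\<Sum>m\<in>?S. \<Prod>k=1..r. real_of_int \<bar>m k\<bar>)"
    using choice_weight_flow[OF w] S by (intro sum.cong refl) blast
  finally show ?thesis .
qed

section \<open>Summation over the tuples and removal of the truncation\<close>

text \<open>There are finitely many tuples, so one threshold serves them all.\<close>

lemma matrix_elements_eventually:
  "\<forall>\<^sub>F B in sequentially. (\<Sum>w\<in>divisor_tuples r a.
       (\<Prod>k=1..r. (1 / real (w k)) ^ (a k div w k)) *
       matrix_element (left_state r a w)
         (op_prod (map (\<lambda>j. cut_join a w (q (inv \<Omega> j))) [1..<n + 1]))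
         (right_state r a w)) =
    (\<Sum>m\<in>bounded_flows B. \<Prod>k=1..r. real_of_int \<bar>m k\<bar>)"
proof -
  have fin: "finite (divisor_tuples r a)"
    unfolding divisor_tuples_def by (intro finite_PiE) (auto simp: conj_commute)
  hence "\<forall>\<^sub>F B in sequentially. \<forall>w\<in>divisor_tuples r a. matrix_element (left_state r a w)
      (op_prod (map (\<lambda>j. cut_join a w (q (inv \<Omega> j))) [1..<n + 1])) (right_state r a w) =
    (\<Sum>f\<in>{1..n} \<rightarrow>\<^sub>E triples B. amplitude (mset (left_modes w)) (vertices_word w f @ right_word w))"
    using matrix_element_expand by (intro eventually_ball_finite) blast+
  thus ?thesis
  proof (rule eventually_mono)
    fix B assume B: "\<forall>w\<in>divisor_tuples r a. matrix_element (left_state r a w)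
      (op_prod (map (\<lambda>j. cut_join a w (q (inv \<Omega> j))) [1..<n + 1])) (right_state r a w) =
    (\<Sum>f\<in>{1..n} \<rightarrow>\<^sub>E triples B. amplitude (mset (left_modes w)) (vertices_word w f @ right_word w))"
    have "(\<Sum>w\<in>divisor_tuples r a. (\<Prod>k=1..r. (1 / real (w k)) ^ (a k div w k)) *
        matrix_element (left_state r a w)
          (op_prod (map (\<lambda>j. cut_join a w (q (inv \<Omega> j))) [1..<n + 1])) (right_state r a w)) =
      (\<Sum>w\<in>divisor_tuples r a. \<Sum>m | m \<in> bounded_flows B \<and> flow_divisors m = w.
        \<Prod>k=1..r. real_of_int \<bar>m k\<bar>)"
    proof (rule sum.cong[OF refl])
      fix w assume w: "w \<in> divisor_tuples r a"
      show "(\<Prod>k=1..r. (1 / real (w k)) ^ (a k div w k)) * matrix_element (left_state r a w)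
          (op_prod (map (\<lambda>j. cut_join a w (q (inv \<Omega> j))) [1..<n + 1])) (right_state r a w) =
        (\<Sum>m | m \<in> bounded_flows B \<and> flow_divisors m = w. \<Prod>k=1..r. real_of_int \<bar>m k\<bar>)"
        unfolding B[rule_format, OF w] sum_choice_weight[OF w, symmetric] sum_distrib_left choice_weight_def
        by (intro sum.cong refl amplitude_eq_prod[OF w, of _ B]) (rule PiE_mem)
    qed
    \<comment> \<open>Every flow has exactly one divisor tuple, so the inner sums partition
      \<open>bounded_flows B\<close>.\<close>
    also have "\<dots> = (\<Sum>m\<in>bounded_flows B. \<Prod>k=1..r. real_of_int \<bar>m k\<bar>)"
      using flow_divisors_mem
      by (intro sum.group finite_bounded_flows fin) (auto simp: bounded_flows_def)
    finally show "(\<Sum>w\<in>divisor_tuples r a. (\<Prod>k=1..r. (1 / real (w k)) ^ (a k div w k)) *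
        matrix_element (left_state r a w)
          (op_prod (map (\<lambda>j. cut_join a w (q (inv \<Omega> j))) [1..<n + 1])) (right_state r a w)) =
      (\<Sum>m\<in>bounded_flows B. \<Prod>k=1..r. real_of_int \<bar>m k\<bar>)" .
  qed
qed

text \<open>
  The sum over the flows bounded by \<open>B\<close> has positive terms and does not depend on \<open>B\<close>
  once \<open>B\<close> is large, so there are no further flows.
\<close>

lemma sum_matrix_elements_eq_sum_flows:
  "(\<Sum>w\<in>divisor_tuples r a.
       (\<Prod>k=1..r. (1 / real (w k)) ^ (a k div w k)) *
       matrix_element (left_state r a w)
         (op_prod (map (\<lambda>j. cut_join a w (q (inv \<Omega> j))) [1..<n + 1]))
         (right_state r a w)) =
    (\<Sum>m\<in>flows. \<Prod>k=1..r. real_of_int \<bar>m k\<bar>)" (is "?lhs = sum ?g flows")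
proof -
  obtain B where B: "\<And>C. C \<ge> B \<Longrightarrow> ?lhs = sum ?g (bounded_flows C)"
    using matrix_elements_eventually unfolding eventually_sequentially by blast
  have pos: "?g m > 0" if "m \<in> flows" for m
    using flowsD(1)[OF that] by (intro prod_pos) simp
  have "m \<in> bounded_flows B" if m: "m \<in> flows" for m
  proof (rule ccontr)
    assume out: "m \<notin> bounded_flows B"
    \<comment> \<open>At least \<open>B\<close> and at least every \<open>\<bar>m k\<bar>\<close>:
      the total is the same for \<open>C\<close> as for \<open>B\<close>, yet it includes the
      additional positive term of \<open>m\<close>.\<close>
    define C where "C = B + (\<Sum>k=1..r. nat \<bar>m k\<bar>)"
    have "\<bar>m k\<bar> \<le> int C" if "k \<in> {1..r}" for k
    proof -
      have "nat \<bar>m k\<bar> \<le> (\<Sum>k=1..r. nat \<bar>m k\<bar>)" using that by (intro member_le_sum) auto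
      thus ?thesis unfolding C_def by linarith
    qed
    hence mC: "m \<in> bounded_flows C" using m by (simp add: bounded_flows_def)
    have "int B \<le> int C" unfolding C_def by linarith
    hence "bounded_flows B \<subseteq> bounded_flows C"
      by (auto simp: bounded_flows_def intro: order_trans)
    hence "sum ?g (insert m (bounded_flows B)) \<le> sum ?g (bounded_flows C)"
      using mC pos by (intro sum_mono2 finite_bounded_flows) (auto simp: bounded_flows_def less_imp_le)
    moreover have "sum ?g (insert m (bounded_flows B)) = ?g m + sum ?g (bounded_flows B)"
      using out finite_bounded_flows by simp
    ultimately show False using pos[OF m] B[of B] B[of C] by (simp add: C_def)
  qed
  hence "bounded_flows B = flows" by (auto simp: bounded_flows_def)
  thus ?thesis using B[of B] by simp
qed

end

theorem theorem3p8:
  fixes L :: real and P :: "nat \<Rightarrow> real"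
    and n r :: nat and ends :: "nat \<Rightarrow> nat set"
    and a :: "nat \<Rightarrow> nat" and \<Omega> :: "nat \<Rightarrow> nat"
    and q :: "nat \<Rightarrow> nat \<Rightarrow> nat"
  assumes circle: "L > 0" "strict_mono_on {0..n} P" "P n < P 0 + L"
    and graph: "feynman_graph n r ends" "graph_connected n r ends"
      "three_valent n r ends" "loopless r ends"
    and order: "\<Omega> permutes {1..n}"
    and adjacent: "\<And>i. i \<in> {1..n} \<Longrightarrow> bij_betw (q i) {1..3} {k \<in> {1..r}. i \<in> ends k}"
  shows "real (cover_count L P n r ends a \<Omega>) =
    (\<Sum>w\<in>divisor_tuples r a.
       (\<Prod>k=1..r. (1 / real (w k)) ^ (a k div w k)) *
       matrix_element (left_state r a w)
         (op_prod (map (\<lambda>j. cut_join a w (q (inv \<Omega> j))) [1..<n + 1]))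
         (right_state r a w))"
proof -
  interpret feynman_operators L P n r ends a \<Omega> q
  proof
    fix i assume i: "i \<in> {1..n}"
    have "q i 1 \<in> {k \<in> {1..r}. i \<in> ends k}"
      using bij_betwE[OF adjacent[OF i]] by simp
    thus "\<exists>k\<in>{1..r}. i \<in> ends k" by blast
  qed (use assms in auto)
  show ?thesis
    unfolding sum_matrix_elements_eq_sum_flows cover_count_eq_sum_flows by simp
qed

end
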